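(* Let $(\alpha_0',\beta_0')\in\mathbb{R}^2$ and suppose that $\alpha,\beta\in C^\infty(\mathbb{R})$, $\alpha>0$, solve the initial value problem $$(1+2\alpha^{-6})\left(\frac{\alpha'}{\alpha}\right)'+(1-4\alpha^{-6})\left(\frac{\alpha'}{\alpha}\right)^2-(\beta')^2=0,\qquad \beta''+2\left(\frac{\alpha'}{\alpha}\right)\beta'=0,$$ $$\alpha(0)=1,\quad\alpha'(0)=\alpha_0',\quad\beta(0)=0,\quad\beta'(0)=\beta_0',$$ with $e_0=3(\alpha_0')^2+(\beta_0')^2\neq0$. If $\beta_0'\neq0$, then $$\beta'(t)=\beta_0'\alpha(t)^{-2},\qquad \alpha''(t)>0\qquad (t\in\mathbb{R}),$$ $$0<e_0^{1/2}-\alpha'(t)\lesssim t^{-2},\quad t\gg1,$$ $$0<\alpha(t)-\bar\alpha(t)\lesssim t^{-1},\quad t\gg1,\quad\text{with}\quad\bar\alpha(t)=e_0^{1/2}t+1-\int_0^\infty(e_0^{1/2}-\alpha'(s))\,ds,$$ $$0<|\beta(t)-\bar\beta|\lesssim t^{-1},\quad t\gg1,\quad\text{with}\quad\bar\beta=\beta_0'\int_0^\infty\alpha(s)^{-2}\,ds.$$ There is a nonempty bounded time interval $(t_1,t_2)\subset\mathbb{R}$ such that the curvature $$\kappa(t)=\frac{3(\alpha'(t)/\alpha(t))^2-(\beta'(t))^2}{e_0(2\alpha(t)^{-2}+\alpha(t)^4)^{1/2}}$$ satisfies $$\begin{cases}\kappa(t)<0,&t\in(t_1,t_2),\\ 0<\kappa(t)\lesssim(1+|t|)^{-4},&t\in\mathbb{R}\setminus[t_1,t_2].\end{cases}$$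 The matrix function $$A(t)=\begin{bmatrix}\alpha(t)I_0&\\&\alpha(t)^{-2}\end{bmatrix}\begin{bmatrix}\exp(\beta(t)W_0)&\\&1\end{bmatrix}$$ satisfies $$A(t)=\begin{bmatrix}[\bar\alpha(t)I_0-(\beta_0'/e_0^{1/2})W_0]\exp(\bar\beta W_0)&\\&0\end{bmatrix}+\mathcal{O}(t^{-2}),\quad t\gg1.$$
   Context: $I_0=\begin{bmatrix}1&0\\0&1\end{bmatrix}$, $W_0=\begin{bmatrix}0&1\\-1&0\end{bmatrix}$; the $3\times3$ matrices displayed are block diagonal (a $2\times2$ block and a $1\times1$ block, zeros elsewhere). For nonnegative functions, $x\lesssim y$ means $x\le c\,y$ on the indicated range with a constant $c>0$ independent of $t$; "$t\gg1$" means for all $t\ge T$ for some $T>0$; $\mathcal{O}(y)$ denotes a quantity whose norm is $\lesssim y$. The matrix $A(t)$ is the solution of the incompressible affine motion equation $A''=\Lambda A^{-\top}$, $\Lambda=\operatorname{tr}[(A'A^{-1})^2]/\operatorname{tr}(A^{-\top}A^{-1})$, in $\mathrm{SL}(3,\mathbb{R})$ corresponding to $(\alpha,\beta)$, and $\kappa$ is its (signed) curvature as a curve in the space of $3\times 3$ matrices. *)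

theory Defs
  imports "HOL-Analysis.Analysis"
begin

definition smooth :: "(real \<Rightarrow> real) \<Rightarrow> bool" where
  "smooth f \<longleftrightarrow> (\<forall>n t. (deriv ^^ n) f field_differentiable (at t))"

text \<open>
  For \<open>f, g \<ge> 0\<close>: \<open>f(t) \<lesssim> g(t)\<close> for \<open>t \<in> S\<close>, with a constant independent of \<open>t\<close>,
  and the same estimate for all sufficiently large \<open>t\<close>.
\<close>

definition lesssim_on :: "real set \<Rightarrow> (real \<Rightarrow> real) \<Rightarrow> (real \<Rightarrow> real) \<Rightarrow> bool" where
  "lesssim_on S f g \<longleftrightarrow> (\<exists>c>0. \<forall>t\<in>S. f t \<le> c * g t)"

definition pos_lesssim_large :: "(real \<Rightarrow> real) \<Rightarrow> (real \<Rightarrow> real) \<Rightarrow> bool" where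
  "pos_lesssim_large f g \<longleftrightarrow> (\<exists>T>0. (\<forall>t\<ge>T. 0 < f t) \<and> lesssim_on {T..} f g)"

definition bigO_large :: "(real \<Rightarrow> 'a::real_normed_vector) \<Rightarrow> (real \<Rightarrow> real) \<Rightarrow> bool" where
  "bigO_large F g \<longleftrightarrow> (\<exists>T>0. lesssim_on {T..} (\<lambda>t. norm (F t)) g)"

text \<open>
  Square matrices carry the product \<open>**\<close>; the multiplication of the type class \<open>times\<close> on
  \<open>vec\<close> is componentwise, so neither \<open>^\<close> nor \<open>exp\<close> of the library can be used for
  matrices. The inner product and the norm on matrices are the Frobenius ones.
\<close>

primrec matrix_power :: "real^'n^'n \<Rightarrow> nat \<Rightarrow> real^'n^'n" where
  "matrix_power M 0 = mat 1"
| "matrix_power M (Suc k) = M ** matrix_power M k"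

definition matrix_exp :: "real^'n^'n \<Rightarrow> real^'n^'n" where
  "matrix_exp M = (\<Sum>k. (1 / fact k) *\<^sub>R matrix_power M k)"

definition I0 :: "real^2^2" where
  "I0 = mat 1"

definition W0 :: "real^2^2" where
  "W0 = vector [vector [0, 1], vector [-1, 0]]"

definition block_diag :: "real^2^2 \<Rightarrow> real \<Rightarrow> real^3^3" where
  "block_diag M c = vector
     [vector [M$1$1, M$1$2, 0],
      vector [M$2$1, M$2$2, 0],
      vector [0,     0,     c]]"

definition inv_transpose :: "real^'n^'n \<Rightarrow> real^'n^'n" where
  "inv_transpose M = transpose (matrix_inv M)"

definition affine_multiplier :: "real^3^3 \<Rightarrow> real^3^3 \<Rightarrow> real" where
  "affine_multiplier M V =
     trace ((V ** matrix_inv M) ** (V ** matrix_inv M)) / trace (inv_transpose M ** matrix_inv M)"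

text \<open>\<open>A\<close> is a curve in \<open>SL(3,\<real>)\<close> with \<open>A'' = \<Lambda> A\<^sup>-\<^sup>T\<close>, where \<open>\<Lambda>\<close> is \<^const>\<open>affine_multiplier\<close> at \<open>(A, A')\<close>.\<close>

definition incompressible_affine_motion :: "(real \<Rightarrow> real^3^3) \<Rightarrow> bool" where
  "incompressible_affine_motion A \<longleftrightarrow>
     (\<exists>V. \<forall>t. det (A t) = 1 \<and>
        (A has_vector_derivative V t) (at t) \<and>
        (V has_vector_derivative affine_multiplier (A t) (V t) *\<^sub>R inv_transpose (A t)) (at t))"

text \<open>The curvature vector of a regular curve: the arc-length derivative of its unit tangent.\<close>

definition unit_tangent :: "(real \<Rightarrow> 'a::real_normed_vector) \<Rightarrow> real \<Rightarrow> 'a" where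
  "unit_tangent \<gamma> t = sgn (vector_derivative \<gamma> (at t))"

definition curvature_vector :: "(real \<Rightarrow> 'a::real_normed_vector) \<Rightarrow> real \<Rightarrow> 'a" where
  "curvature_vector \<gamma> t =
     vector_derivative (unit_tangent \<gamma>) (at t) /\<^sub>R norm (vector_derivative \<gamma> (at t))"

text \<open>
  The gradient of \<open>det\<close> at a point \<open>M\<close> of \<open>SL(3,\<real>)\<close> is \<open>M\<^sup>-\<^sup>T\<close>. The curvature vector of an
  incompressible affine motion is a multiple of this normal, and the sign of its curvature is
  taken relative to it.
\<close>

definition SL_unit_normal :: "real^3^3 \<Rightarrow> real^3^3" where
  "SL_unit_normal M = sgn (inv_transpose M)"

definition has_signed_curvature :: "(real \<Rightarrow> real^3^3) \<Rightarrow> real \<Rightarrow> real \<Rightarrow> bool" where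
  "has_signed_curvature A k t \<longleftrightarrow> curvature_vector A t = k *\<^sub>R SL_unit_normal (A t)"

end

theory Submission
  imports Defs
begin

text \<open>
  The motion is a curve in a Euclidean space of matrices that moves with constant speed, because it
  is a geodesic of \<open>SL(3,\<real>)\<close>; everything follows from its being very nearly straight for large
  times. A matrix with a block \<open>x I\<^sub>0 + y W\<^sub>0\<close> and a last diagonal entry \<open>c\<close> is treated as the pair of
  the complex number \<open>z = x + i y\<close> and the real number \<open>c\<close>; products, inverses, transposes and
  exponentials become those of \<open>\<complex> \<times> \<real>\<close>, and the motion is \<open>(a e\<^sup>i\<^sup>\<beta>, a\<^sup>-\<^sup>2)\<close>, where \<open>a = \<alpha>\<close>.

  The second equation says that \<open>\<beta>' a\<^sup>2\<close> is a constant \<open>b\<close>. The first then makes \<open>a''\<close> positive and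
  conserves the energy \<open>(1 + 2 a\<^sup>-\<^sup>6) a'\<^sup>2 + b\<^sup>2 a\<^sup>-\<^sup>2 = e\<close>, which is half of the squared speed. The energy
  bounds \<open>a\<close> below and \<open>\<bar>a'\<bar>\<close> by \<open>\<surd>e\<close>, and it gives for \<open>p = a a'\<close>, half of the derivative of \<open>a\<^sup>2\<close>,
  that \<open>(1 + 2 a\<^sup>-\<^sup>6) p' \<ge> e\<close>. Hence \<open>p\<close> grows at a positive rate (\<open>p_increment\<close>) and \<open>a\<^sup>2\<close> quadratically
  in both time directions (\<open>linear_growth\<close>). Now \<open>\<surd>e - a'\<close> and \<open>\<beta>'\<close> are of order \<open>t\<^sup>-\<^sup>2\<close> by the energy
  identity, so they are integrable and their tails are of order \<open>t\<^sup>-\<^sup>1\<close>. The curvature has the sign of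
  \<open>3 p\<^sup>2 - b\<^sup>2\<close>; as \<open>p\<close> increases strictly through all real values, this is negative exactly on one
  bounded interval, and the bound on the curvature is the growth of \<open>a\<close>.

  For the final expansion, integrate the acceleration twice from infinity. In the frame turned by the limit
  angle, \<open>\<delta>\<close> being the remaining angle, the motion differs from the proposed straight line by
  \<open>X = a cos \<delta> - abar\<close> and \<open>Y = a sin \<delta> + b / \<surd>e\<close>. Each of \<open>X''\<close> and \<open>Y''\<close> is the acceleration
  \<open>a'' - a \<beta>'\<^sup>2\<close> times a factor of modulus at most 1, hence at most of order \<open>t\<^sup>-\<^sup>4\<close>
  (\<open>normal_acceleration_decay\<close>). So \<open>X\<close> and \<open>Y\<close> are of order \<open>t\<^sup>-\<^sup>2\<close> as soon as they and their first
  derivatives tend to 0. The one delicate limit is \<open>a \<delta> \<longlongrightarrow> - b / \<surd>e\<close> (\<open>radius_times_\<delta>\<close>).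
\<close>

section \<open>Block matrices as pairs of a complex and a real number\<close>

text \<open>
  The regular representation of \<open>\<complex>\<close> on \<open>\<real>\<^sup>2\<close>, up to orientation: \<open>W0\<close> stands for the imaginary unit.
\<close>

definition complex_matrix :: "complex \<Rightarrow> real^2^2" where
  "complex_matrix z = Re z *\<^sub>R I0 + Im z *\<^sub>R W0"

definition block_embed :: "complex \<Rightarrow> real \<Rightarrow> real^3^3" where
  "block_embed z c = block_diag (complex_matrix z) c"

lemma complex_matrix_entries:
  "complex_matrix z $ 1 $ 1 = Re z" "complex_matrix z $ 1 $ 2 = Im z"
  "complex_matrix z $ 2 $ 1 = - Im z" "complex_matrix z $ 2 $ 2 = Re z"
  by (simp_all add: complex_matrix_def I0_def W0_def mat_def)

lemma complex_matrix_mult: "complex_matrix z ** complex_matrix w = complex_matrix (z * w)"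
  by (simp add: vec_eq_iff forall_2 matrix_matrix_mult_def sum_2 complex_matrix_entries algebra_simps)

lemma bounded_linear_complex_matrix: "bounded_linear complex_matrix"
  unfolding linear_conv_bounded_linear[symmetric]
  by (intro linearI) (simp_all add: complex_matrix_def algebra_simps)

lemma block_embed_entries:
  "block_embed z c $ 1 = vector [Re z, Im z, 0]" "block_embed z c $ 2 = vector [- Im z, Re z, 0]"
  "block_embed z c $ 3 = vector [0, 0, c]"
  by (simp_all add: block_embed_def block_diag_def complex_matrix_entries)

lemma block_embed_mult: "block_embed z c ** block_embed w d = block_embed (z * w) (c * d)"
  by (simp add: vec_eq_iff forall_3 matrix_matrix_mult_def sum_3 block_embed_entries algebra_simps)

lemma block_embed_linear:
  "block_embed z c + block_embed w d = block_embed (z + w) (c + d)"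
  "block_embed z c - block_embed w d = block_embed (z - w) (c - d)"
  "r *\<^sub>R block_embed z c = block_embed (r *\<^sub>R z) (r * c)"
  by (simp_all add: vec_eq_iff forall_3 block_embed_entries)

lemma block_embed_one: "block_embed 1 1 = mat 1"
  by (simp add: vec_eq_iff forall_3 block_embed_entries mat_def)

text \<open>
  The factor 2 arises because each of the real and imaginary parts occupies two matrix entries.
\<close>

lemma norm_block_embed: "norm (block_embed z c) = sqrt (2 * (cmod z)\<^sup>2 + c\<^sup>2)"
  unfolding norm_eq_sqrt_inner cmod_power2
  by (simp add: inner_vec_def sum_3 block_embed_entries inner_complex_def cmod_power2 power2_eq_square)

lemma det_block_embed: "det (block_embed z c) = (cmod z)\<^sup>2 * c"
  unfolding cmod_power2 by (simp add: det_3 block_embed_entries power2_eq_square algebra_simps)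

lemma trace_block_embed: "trace (block_embed z c) = 2 * Re z + c"
  by (simp add: trace_def sum_3 block_embed_entries)

lemma transpose_block_embed: "transpose (block_embed z c) = block_embed (cnj z) c"
  by (simp add: vec_eq_iff forall_3 transpose_def block_embed_entries)

lemma matrix_inv_eqI:
  fixes M N :: "real^'n^'n"
  assumes "M ** N = mat 1" "N ** M = mat 1"
  shows "matrix_inv M = N"
proof -
  have inv: "matrix_inv M ** M = mat 1"
    unfolding matrix_inv_def by (rule someI2[where a = N]) (use assms in auto)
  have "matrix_inv M = matrix_inv M ** (M ** N)"
    by (simp add: assms)
  also have "\<dots> = N"
    unfolding matrix_mul_assoc inv by simp
  finally show ?thesis .
qed

lemma matrix_inv_block_embed:
  assumes "z \<noteq> 0" "c \<noteq> 0"
  shows "matrix_inv (block_embed z c) = block_embed (inverse z) (inverse c)"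
  by (rule matrix_inv_eqI) (use assms in \<open>simp_all add: block_embed_mult block_embed_one\<close>)

text \<open>
  Curves of block matrices are differentiated through their two coordinates.
\<close>

lemma bounded_linear_block_embed: "bounded_linear (\<lambda>(z, c). block_embed z c)"
  unfolding linear_conv_bounded_linear[symmetric]
  by (intro linearI) (auto simp: block_embed_linear)

lemma has_vector_derivative_block_embed:
  assumes "(z has_vector_derivative z') (at t within S)"
    and "(c has_real_derivative c') (at t within S)"
  shows "((\<lambda>t. block_embed (z t) (c t)) has_vector_derivative block_embed z' c') (at t within S)"
  using bounded_linear.has_vector_derivative[OF bounded_linear_block_embed
      has_vector_derivative_Pair[OF assms(1) assms(2)[unfolded has_real_derivative_iff_has_vector_derivative]]]
  by simp

lemma norm_block_embed_le: "norm (block_embed z c) \<le> 2 * cmod z + \<bar>c\<bar>"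
proof -
  have "2 * (cmod z)\<^sup>2 + c\<^sup>2 \<le> (2 * cmod z + \<bar>c\<bar>)\<^sup>2"
    by (simp add: power2_sum)
  then show ?thesis
    unfolding norm_block_embed by (intro real_le_lsqrt) auto
qed

lemma inv_transpose_block_embed:
  assumes "z \<noteq> 0" "c \<noteq> 0"
  shows "inv_transpose (block_embed z c) = block_embed (inverse (cnj z)) (inverse c)"
  using assms by (simp add: inv_transpose_def matrix_inv_block_embed transpose_block_embed)

text \<open>
  The product rule for \<open>(x + i y) e\<^sup>i\<^sup>\<theta>\<close>: differentiating the rotation turns the coordinates by a right
  angle and scales them by \<open>\<theta>'\<close>.
\<close>

lemma has_vector_derivative_rotating_frame:
  assumes "(x has_real_derivative x') (at t)" "(y has_real_derivative y') (at t)"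
    and "(\<theta> has_real_derivative \<theta>') (at t)"
  shows "((\<lambda>t. Complex (x t) (y t) * cis (\<theta> t)) has_vector_derivative
    Complex (x' - y t * \<theta>') (y' + x t * \<theta>') * cis (\<theta> t)) (at t)"
  using assms unfolding has_vector_derivative_def has_field_derivative_def Complex_eq
  by (auto intro!: derivative_eq_intros simp: fun_eq_iff scaleR_conv_of_real algebra_simps)

lemma matrix_power_complex_matrix: "matrix_power (complex_matrix z) n = complex_matrix (z ^ n)"
  by (induction n) (simp_all add: complex_matrix_mult, simp add: complex_matrix_def I0_def)

text \<open>
  The embedding of \<open>\<complex>\<close> is multiplicative and continuous, so it maps the exponential series term by term.
\<close>

lemma matrix_exp_complex_matrix: "matrix_exp (complex_matrix z) = complex_matrix (exp z)"
proof -
  have "(\<lambda>n. complex_matrix (z ^ n /\<^sub>R fact n)) sums complex_matrix (exp z)"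
    by (intro bounded_linear.sums[OF bounded_linear_complex_matrix] exp_converges)
  moreover have "complex_matrix (z ^ n /\<^sub>R fact n) = (1 / fact n) *\<^sub>R matrix_power (complex_matrix z) n" for n
    using linear_scale[OF bounded_linear.linear[OF bounded_linear_complex_matrix]]
    by (simp add: matrix_power_complex_matrix inverse_eq_divide del: scaleR_complex.simps)
  ultimately show ?thesis
    unfolding matrix_exp_def by (simp add: sums_iff)
qed

section \<open>Integrating decay from infinity\<close>

text \<open>
  Both \<open>g + f\<close> and \<open>g - f\<close> are nonincreasing with limit 0, hence nonnegative. This replaces the
  integral of \<open>f'\<close> over \<open>{t..}\<close>.
\<close>

lemma abs_le_of_derivative_decay:
  fixes f g f' g' :: "real \<Rightarrow> real"
  assumes f: "\<And>t. t \<ge> T \<Longrightarrow> (f has_real_derivative f' t) (at t)" "(f \<longlongrightarrow> 0) at_top"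
    and g: "\<And>t. t \<ge> T \<Longrightarrow> (g has_real_derivative g' t) (at t)" "(g \<longlongrightarrow> 0) at_top"
    and le: "\<And>t. t \<ge> T \<Longrightarrow> \<bar>f' t\<bar> \<le> - g' t"
    and t: "t \<ge> T"
  shows "\<bar>f t\<bar> \<le> g t"
proof -
  have "0 \<le> g t + r * f t" if r: "\<bar>r\<bar> = 1" for r
  proof (rule tendsto_upperbound)
    show "((\<lambda>s. g s + r * f s) \<longlongrightarrow> 0) at_top"
      using tendsto_add[OF g(2) tendsto_mult[OF tendsto_const[of r] f(2)]] by simp
    show "\<forall>\<^sub>F s in at_top. g s + r * f s \<le> g t + r * f t"
    proof (rule eventually_at_top_linorderI[of t])
      fix s assume "t \<le> s"
      then show "g s + r * f s \<le> g t + r * f t"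
      proof (rule DERIV_nonpos_imp_nonincreasing)
        fix x assume "t \<le> x" "x \<le> s"
        then have x: "x \<ge> T" using t by simp
        have "r * f' x \<le> \<bar>f' x\<bar>"
          using abs_ge_self[of "r * f' x"] by (simp add: abs_mult r)
        then show "\<exists>y. ((\<lambda>s. g s + r * f s) has_real_derivative y) (at x) \<and> y \<le> 0"
          using le[OF x] by (intro exI[of _ "g' x + r * f' x"])
            (auto intro!: derivative_eq_intros f(1) g(1) x)
      qed
    qed
  qed simp
  from this[of 1] this[of "-1"] show ?thesis by simp
qed

text \<open>
  \<open>F\<close> increases while \<open>F + C / t\<close> decreases on \<open>{T..}\<close>, so \<open>F\<close> converges and the limit lies between
  the two.
\<close>

lemma convergence_with_quadratic_rate:
  fixes F f :: "real \<Rightarrow> real"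
  assumes F: "\<And>t. (F has_real_derivative f t) (at t)"
    and f_pos: "\<And>t. f t > 0"
    and le: "\<And>t. t \<ge> T \<Longrightarrow> f t \<le> C / t\<^sup>2"
    and T: "T > 0"
  shows "\<exists>L. (F \<longlongrightarrow> L) at_top \<and> (\<forall>t. F t < L) \<and> (\<forall>t\<ge>T. L - F t \<le> C / t)"
proof -
  have mono: "F s < F t" if "s < t" for s t
    by (rule DERIV_pos_imp_increasing[OF that]) (use F f_pos in blast)
  have bound: "F s \<le> F t + C / t" if "T \<le> t" "t \<le> s" for s t
  proof -
    have "C > 0"
      using le[of T] f_pos[of T] T
      by (metis order_less_le_trans order_refl zero_less_divide_iff zero_less_power not_less_iff_gr_or_eq)
    have "F s + C / s \<le> F t + C / t"
    proof (rule DERIV_nonpos_imp_nonincreasing[OF \<open>t \<le> s\<close>])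
      fix x assume "t \<le> x" "x \<le> s"
      then have x: "T \<le> x" "x > 0" using that T by auto
      have "((\<lambda>s. F s + C / s) has_real_derivative f x - C / x\<^sup>2) (at x)"
        using x by (auto intro!: derivative_eq_intros F simp: power2_eq_square)
      then show "\<exists>y. ((\<lambda>s. F s + C / s) has_real_derivative y) (at x) \<and> y \<le> 0"
        using le[OF x(1)] by (intro exI[of _ "f x - C / x\<^sup>2"]) simp
    qed
    moreover have "C / s \<ge> 0" using \<open>C > 0\<close> that T by simp
    ultimately show ?thesis by linarith
  qed
  define L where "L = (SUP s. F s)"
  have bdd: "bdd_above (range F)"
  proof (rule bdd_aboveI2)
    fix s
    show "F s \<le> F T + C / T"
      using bound[of T "max s T"] mono[of s "max s T"] by (cases "s < T") (auto simp: max_def)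
  qed
  have lt: "F t < L" for t
    using mono[of t "t + 1"] cSUP_upper[OF UNIV_I bdd, of "t + 1"] unfolding L_def by simp
  have "(F \<longlongrightarrow> L) at_top"
  proof (rule order_tendstoI)
    fix y assume "y < L"
    then obtain s where "y < F s"
      unfolding L_def by (metis less_cSUP_iff[OF UNIV_not_empty bdd] UNIV_I)
    then show "\<forall>\<^sub>F t in at_top. y < F t"
      by (intro eventually_at_top_linorderI[of s]) (metis mono order_le_less order_less_trans)
  next
    fix y assume "L < y"
    then show "\<forall>\<^sub>F t in at_top. F t < y"
      using lt by (intro always_eventually allI) (meson order_less_trans)
  qed
  moreover have "L - F t \<le> C / t" if "t \<ge> T" for t
  proof -
    have "L \<le> F t + C / t"
      unfolding L_def
    proof (rule cSUP_least)
      fix s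
      show "F s \<le> F t + C / t"
        using bound[OF that, of "max s t"] mono[of s "max s t"] by (cases "s < t") (auto simp: max_def)
    qed simp
    then show ?thesis by simp
  qed
  ultimately show ?thesis using lt by blast
qed

lemma has_integral_nonneg_derivative_to_inf:
  fixes F f :: "real \<Rightarrow> real"
  assumes F: "\<And>t. t \<ge> a \<Longrightarrow> (F has_real_derivative f t) (at t)"
    and f_nonneg: "\<And>t. t \<ge> a \<Longrightarrow> f t \<ge> 0"
    and lim: "(F \<longlongrightarrow> L) at_top"
  shows "(f has_integral (L - F a)) {a..}"
proof (rule has_integral_to_inf)
  have I: "(f has_integral (F y - F a)) {a..y}" if "a \<le> y" for y
    using F by (intro fundamental_theorem_of_calculus[OF that])
      (auto simp flip: has_real_derivative_iff_has_vector_derivative intro: has_field_derivative_at_within)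
  then show "f integrable_on {a..y}" for y
    by (cases "a \<le> y") (auto simp: integrable_on_def intro: has_integral_empty)
  have "((\<lambda>y. F y - F a) \<longlongrightarrow> L - F a) at_top"
    by (intro tendsto_intros lim)
  then show "((\<lambda>y. integral {a..y} f) \<longlongrightarrow> L - F a) at_top"
    by (rule Lim_transform_eventually)
      (auto intro!: eventually_at_top_linorderI[of a] simp: integral_unique[OF I])
qed (use f_nonneg in auto)

text \<open>
  Applied to a curve minus a straight line to which it is asymptotic, this bounds the distance by the
  acceleration alone.
\<close>

lemma abs_le_of_second_derivative_decay:
  fixes f f' f'' :: "real \<Rightarrow> real"
  assumes f: "\<And>t. (f has_real_derivative f' t) (at t)" "(f \<longlongrightarrow> 0) at_top"
    and f': "\<And>t. (f' has_real_derivative f'' t) (at t)" "(f' \<longlongrightarrow> 0) at_top"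
    and le: "\<And>t. t \<ge> T \<Longrightarrow> \<bar>f'' t\<bar> \<le> C / t ^ 4"
    and T: "T > 0" "t \<ge> T"
  shows "\<bar>f t\<bar> \<le> (C / 6) / t ^ 2"
proof -
  have lim: "((\<lambda>t::real. c / (d * t ^ n)) \<longlongrightarrow> 0) at_top" if "n > 0" "d > 0" for c d n
    by (intro real_tendsto_divide_at_top[OF tendsto_const]
        filterlim_tendsto_pos_mult_at_top[OF tendsto_const] filterlim_pow_at_top filterlim_ident that)
  have f'_le: "\<bar>f' t\<bar> \<le> (C / 3) / t ^ 3" if "t \<ge> T" for t
  proof (rule abs_le_of_derivative_decay[OF f'])
    show "((\<lambda>t. (C / 3) / t ^ 3) has_real_derivative - C / s ^ 4) (at s)" if "s \<ge> T" for s
      using that T by (auto intro!: derivative_eq_intros simp: field_simps eval_nat_numeral)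
  qed (use that le in \<open>auto intro: lim\<close>)
  show ?thesis
  proof (rule abs_le_of_derivative_decay[OF f])
    show "((\<lambda>t. (C / 6) / t ^ 2) has_real_derivative - (C / 3) / s ^ 3) (at s)" if "s \<ge> T" for s
      using that T by (auto intro!: derivative_eq_intros simp: field_simps eval_nat_numeral)
  qed (use T f'_le in \<open>auto intro: lim\<close>)
qed

section \<open>Energy and growth of the radius\<close>

text \<open>
  The first-order and algebraic content of the initial value problem: conservation of \<open>\<beta>' a\<^sup>2 = b\<close> is
  already used to eliminate \<open>\<beta>'\<close>, and the radial equation is multiplied by \<open>a\<^sup>8\<close> to clear its denominators.
\<close>

locale swirling_profile =
  fixes a a' a'' \<beta> :: "real \<Rightarrow> real" and b e :: real
  assumes a_pos: "\<And>t. a t > 0"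
    and deriv_a: "\<And>t. (a has_real_derivative a' t) (at t)"
    and deriv_a': "\<And>t. (a' has_real_derivative a'' t) (at t)"
    and deriv_\<beta>: "\<And>t. (\<beta> has_real_derivative b / (a t)\<^sup>2) (at t)"
    and accel: "\<And>t. (a t ^ 6 + 2) * (a t * a'' t) = 6 * (a' t)\<^sup>2 + b\<^sup>2 * a t ^ 4"
    and init: "a 0 = 1" "\<beta> 0 = 0"
    and e: "e = 3 * (a' 0)\<^sup>2 + b\<^sup>2"
    and b: "b \<noteq> 0"
begin

lemma e_pos: "e > 0"
  using b unfolding e by (simp add: add_nonneg_pos)

lemma a_nz [simp]: "a t \<noteq> 0"
  using a_pos[of t] by simp

lemma a6_nz [simp]: "a t ^ 6 + 2 \<noteq> 0"
  using zero_less_power[OF a_pos[of t], of 6] by linarith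

text \<open>
  The derivative of the left-hand side is a multiple of the difference of the two sides of the equation
  of motion.
\<close>

lemma energy: "(1 + 2 / a t ^ 6) * (a' t)\<^sup>2 + b\<^sup>2 / (a t)\<^sup>2 = e"
proof -
  define E where "E t = (1 + 2 / a t ^ 6) * (a' t)\<^sup>2 + b\<^sup>2 / (a t)\<^sup>2" for t
  have "(E has_real_derivative 0) (at t)" for t
  proof -
    have "(E has_real_derivative 2 * a' t / a t ^ 7 *
        ((a t ^ 6 + 2) * (a t * a'' t) - 6 * (a' t)\<^sup>2 - b\<^sup>2 * a t ^ 4)) (at t)"
      unfolding E_def
      by (auto intro!: derivative_eq_intros deriv_a deriv_a') (simp add: field_simps eval_nat_numeral)
    then show ?thesis
      by (simp add: accel)
  qed
  then have "E t = E 0"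
    by (rule DERIV_isconst_all[rule_format])
  then show ?thesis
    by (simp add: E_def init e)
qed

lemma energy_poly: "(a t ^ 6 + 2) * (a' t)\<^sup>2 + b\<^sup>2 * a t ^ 4 = e * a t ^ 6"
proof -
  have "(a t ^ 6 + 2) * (a' t)\<^sup>2 + b\<^sup>2 * a t ^ 4 = ((1 + 2 / a t ^ 6) * (a' t)\<^sup>2 + b\<^sup>2 / (a t)\<^sup>2) * a t ^ 6"
    by (simp add: field_simps eval_nat_numeral)
  then show ?thesis
    by (simp add: energy)
qed

lemma accel_pos: "a'' t > 0"
proof -
  have "0 < (a t ^ 6 + 2) * (a t * a'' t)"
    unfolding accel using b a_pos[of t] by (intro add_nonneg_pos) auto
  then show ?thesis
    using a_pos[of t] zero_less_power[OF a_pos[of t], of 6] by (auto simp: zero_less_mult_iff)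
qed

lemma speed_sq_less: "(a' t)\<^sup>2 < e"
proof -
  have "(a' t)\<^sup>2 + 2 / a t ^ 6 * (a' t)\<^sup>2 + b\<^sup>2 / (a t)\<^sup>2 = e"
    using energy[of t] by (simp add: algebra_simps)
  moreover have "b\<^sup>2 / (a t)\<^sup>2 > 0" "2 / a t ^ 6 * (a' t)\<^sup>2 \<ge> 0"
    using b a_pos[of t] by auto
  ultimately show ?thesis
    by linarith
qed

lemmas speed_sq_le = speed_sq_less[THEN less_imp_le]

lemma speed_less: "\<bar>a' t\<bar> < sqrt e"
  using speed_sq_less by (intro real_less_rsqrt) simp

text \<open>
  The centrifugal term \<open>b\<^sup>2 / a\<^sup>2\<close> of the energy cannot exceed \<open>e\<close>, which keeps the radius away from 0.
\<close>

lemma a_sq_ge: "b\<^sup>2 / e \<le> (a t)\<^sup>2"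
proof -
  have "(1 + 2 / a t ^ 6) * (a' t)\<^sup>2 \<ge> 0"
    using a_pos[of t] by auto
  then have "b\<^sup>2 / (a t)\<^sup>2 \<le> e"
    using energy[of t] by linarith
  then show ?thesis
    using e_pos a_pos[of t] by (simp add: field_simps)
qed

lemma b_sq_pos: "b\<^sup>2 / e > 0"
  using b e_pos by simp

text \<open>
  Half of the derivative of \<open>a\<^sup>2\<close>; the sign changes of the curvature are read off from it.
\<close>

definition p :: "real \<Rightarrow> real" where
  "p t = a t * a' t"

lemma deriv_p: "(p has_real_derivative (a' t)\<^sup>2 + a t * a'' t) (at t)"
  unfolding p_def by (auto intro!: derivative_eq_intros deriv_a deriv_a' simp: power2_eq_square)

text \<open>
  The equation of motion and the energy identity add up to \<open>(a\<^sup>6 + 2) p' = e a\<^sup>6 + 6 a'\<^sup>2\<close>, and the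
  radius is bounded below, so \<open>p'\<close> is bounded below by a positive constant.
\<close>

lemma p_increment: "\<exists>k>0. \<forall>s t. s \<le> t \<longrightarrow> p s + k * (t - s) \<le> p t"
proof -
  \<comment> \<open>the lower bound of \<open>a\<^sup>6\<close>; \<open>k\<close> is the value at \<open>a\<^sup>6 = m\<close> of the increasing function \<open>e a\<^sup>6 / (a\<^sup>6 + 2)\<close>\<close>
  define m where "m = (b\<^sup>2 / e) ^ 3"
  have m_pos: "m > 0"
    using b_sq_pos by (simp add: m_def)
  have m_le: "m \<le> a t ^ 6" for t
    using power_mono[OF a_sq_ge, of 3 t] b_sq_pos by (simp add: m_def flip: power_mult)
  define k where "k = e * m / (m + 2)"
  have k: "k > 0"
    using m_pos e_pos by (simp add: k_def)
  have le: "k \<le> (a' t)\<^sup>2 + a t * a'' t" for t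
  proof -
    have "k \<le> e * a t ^ 6 / (a t ^ 6 + 2)"
      using m_pos m_le[of t] e_pos unfolding k_def by (simp add: field_simps add_pos_pos)
    also have "\<dots> \<le> (a' t)\<^sup>2 + a t * a'' t"
      using energy_poly[of t] accel[of t] a_pos[of t]
      by (simp add: pos_divide_le_eq add_pos_pos algebra_simps)
    finally show ?thesis .
  qed
  have "p s + k * (t - s) \<le> p t" if "s \<le> t" for s t
  proof -
    have "p s - k * s \<le> p t - k * t"
    proof (rule DERIV_nonneg_imp_nondecreasing[OF that])
      fix x
      show "\<exists>y. ((\<lambda>t. p t - k * t) has_real_derivative y) (at x) \<and> 0 \<le> y"
        using le[of x] by (intro exI[of _ "(a' x)\<^sup>2 + a x * a'' x - k"])
          (auto intro!: derivative_eq_intros deriv_p)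
    qed
    then show ?thesis by (simp add: algebra_simps)
  qed
  with k show ?thesis by blast
qed

text \<open>
  Integrating the lower bound of \<open>p'\<close> twice gives a quadratic lower bound of \<open>a\<^sup>2\<close>, in both time
  directions at once. Near \<open>t = 0\<close>, where that bound may be negative, \<open>a_sq_ge\<close> takes over.
\<close>

lemma linear_growth: "\<exists>c>0. \<forall>t. c * (1 + \<bar>t\<bar>) \<le> a t"
proof -
  obtain k where k: "k > 0" and p: "\<And>s t. s \<le> t \<Longrightarrow> p s + k * (t - s) \<le> p t"
    using p_increment by blast
  \<comment> \<open>\<open>g' = 2 (p t - p 0 - k t)\<close> has the sign of \<open>t\<close>, so \<open>g\<close> has its minimum at 0\<close>
  define g where "g t = (a t)\<^sup>2 - 2 * p 0 * t - k * t\<^sup>2" for t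
  have g: "(g has_real_derivative 2 * (p t - p 0 - k * t)) (at t)" for t
    unfolding g_def p_def by (auto intro!: derivative_eq_intros deriv_a simp: algebra_simps)
  have "g 0 \<le> g t" for t
  proof (cases "t \<ge> 0")
    case True
    show ?thesis
    proof (rule DERIV_nonneg_imp_nondecreasing[OF True])
      fix x :: real assume "0 \<le> x"
      then show "\<exists>y. (g has_real_derivative y) (at x) \<and> 0 \<le> y"
        using p[of 0 x] by (intro exI[of _ "2 * (p x - p 0 - k * x)"] conjI g) (simp add: algebra_simps)
    qed
  next
    case False
    then have "t \<le> 0" by simp
    then show ?thesis
    proof (rule DERIV_nonpos_imp_nonincreasing)
      fix x :: real assume "x \<le> 0"
      then show "\<exists>y. (g has_real_derivative y) (at x) \<and> y \<le> 0"
        using p[of x 0] by (intro exI[of _ "2 * (p x - p 0 - k * x)"] conjI g) (simp add: algebra_simps)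
    qed
  qed
  then have quad: "1 + 2 * p 0 * t + k * t\<^sup>2 \<le> (a t)\<^sup>2" for t
    by (simp add: g_def init algebra_simps)
  define m where "m = b\<^sup>2 / e"
  have m: "m > 0" "m \<le> (a t)\<^sup>2" for t
    using b_sq_pos a_sq_ge by (auto simp: m_def)
  define D where "D = 2 * (p 0)\<^sup>2 / k"
  have D: "D \<ge> 0" using k by (simp add: D_def)
  have t_sq: "t\<^sup>2 \<le> 2 / k * ((a t)\<^sup>2 + D)" for t
  proof -
    \<comment> \<open>completing the square absorbs the linear term into half of the quadratic one, at the cost of \<open>D\<close>\<close>
    have "0 \<le> (2 * p 0 + k * t)\<^sup>2 / (2 * k)"
      using k by simp
    also have "\<dots> = D + 2 * p 0 * t + k / 2 * t\<^sup>2"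
      using k by (simp add: D_def field_simps power2_eq_square)
    finally have "k / 2 * t\<^sup>2 \<le> (a t)\<^sup>2 + D"
      using quad[of t] by (simp add: field_simps)
    then show ?thesis
      using k by (simp add: field_simps)
  qed
  \<comment> \<open>constants are converted into multiples of \<open>a\<^sup>2\<close> by \<open>1 \<le> a\<^sup>2 / m\<close>; the factor 2 is from \<open>(1 + \<bar>t\<bar>)\<^sup>2 \<le> 2 (1 + t\<^sup>2)\<close>\<close>
  define M where "M = 2 * (1 / m + 2 / k * (1 + D / m))"
  have M: "M > 0"
    using m k D by (simp add: M_def add_pos_nonneg)
  have "1 / sqrt M * (1 + \<bar>t\<bar>) \<le> a t" for t
  proof -
    have "1 \<le> (a t)\<^sup>2 / m"
      using m by simp
    then have "D \<le> D * ((a t)\<^sup>2 / m)"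
      using D mult_left_mono by fastforce
    then have "2 / k * ((a t)\<^sup>2 + D) \<le> 2 / k * ((a t)\<^sup>2 + D * ((a t)\<^sup>2 / m))"
      using k by (intro mult_left_mono) auto
    with t_sq[of t] have "t\<^sup>2 \<le> 2 / k * ((a t)\<^sup>2 + D * ((a t)\<^sup>2 / m))"
      by (rule order_trans)
    with \<open>1 \<le> (a t)\<^sup>2 / m\<close> have "2 * (1 + t\<^sup>2) \<le> 2 * ((a t)\<^sup>2 / m + 2 / k * ((a t)\<^sup>2 + D * ((a t)\<^sup>2 / m)))"
      by (intro mult_left_mono add_mono) simp_all
    also have "\<dots> = M * (a t)\<^sup>2"
      using m k by (simp add: M_def field_simps)
    also have "(1 + \<bar>t\<bar>)\<^sup>2 \<le> 2 * (1 + t\<^sup>2)"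
      using zero_le_power2[of "1 - \<bar>t\<bar>"] by (simp add: power2_eq_square algebra_simps)
    finally have "(1 + \<bar>t\<bar>)\<^sup>2 \<le> M * (a t)\<^sup>2"
      by simp
    then have "1 + \<bar>t\<bar> \<le> sqrt (M * (a t)\<^sup>2)"
      by (intro real_le_rsqrt)
    then show ?thesis
      using M a_pos[of t] by (simp add: real_sqrt_mult field_simps)
  qed
  then show ?thesis
    using M by (intro exI[of _ "1 / sqrt M"]) auto
qed

lemma tends_to_infinity: "filterlim a at_top at_top"
proof -
  obtain c where c: "c > 0" "\<And>t. c * (1 + \<bar>t\<bar>) \<le> a t"
    using linear_growth by blast
  show ?thesis
  proof (rule filterlim_at_top_mono)
    show "filterlim (\<lambda>t. c * t) at_top at_top"
      by (intro filterlim_tendsto_pos_mult_at_top[OF tendsto_const c(1) filterlim_ident])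
    show "\<forall>\<^sub>F t in at_top. c * t \<le> a t"
    proof (rule eventually_at_top_linorderI[of 0])
      fix t :: real assume "t \<ge> 0"
      then show "c * t \<le> a t" using c(2)[of t] c(1) by (simp add: algebra_simps)
    qed
  qed
qed

lemma inverse_square_decay: "\<exists>C>0. \<forall>t>0. 1 / (a t)\<^sup>2 \<le> C / t\<^sup>2"
proof -
  obtain c where c: "c > 0" "\<And>t. c * (1 + \<bar>t\<bar>) \<le> a t"
    using linear_growth by blast
  have "1 / (a t)\<^sup>2 \<le> (1 / c\<^sup>2) / t\<^sup>2" if "t > 0" for t
  proof -
    have "c * t \<le> a t" using c(2)[of t] c(1) that by (simp add: algebra_simps)
    then have "c\<^sup>2 * t\<^sup>2 \<le> (a t)\<^sup>2"
      using c(1) that power_mono[of "c * t" "a t" 2] by (simp add: power_mult_distrib)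
    then show ?thesis
      using c(1) that by (simp add: frac_le)
  qed
  then show ?thesis
    using c(1) by (intro exI[of _ "1 / c\<^sup>2"]) auto
qed

text \<open>
  By the energy identity \<open>e - a'\<^sup>2\<close> is of order \<open>a\<^sup>-\<^sup>2\<close>. Dividing by \<open>\<surd>e + a'\<close> is harmless once
  \<open>p\<close>, and with it \<open>a'\<close>, has become nonnegative.
\<close>

lemma speed_deficit_decay: "\<exists>C>0. \<exists>T>0. \<forall>t\<ge>T. sqrt e - a' t \<le> C / t\<^sup>2"
proof -
  obtain C where C: "C > 0" "\<And>t. t > 0 \<Longrightarrow> 1 / (a t)\<^sup>2 \<le> C / t\<^sup>2"
    using inverse_square_decay by blast
  obtain k where k: "k > 0" "\<And>s t. s \<le> t \<Longrightarrow> p s + k * (t - s) \<le> p t"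
    using p_increment by blast
  \<comment> \<open>from this time on \<open>p 0 + k t \<ge> 0\<close>, which bounds \<open>p\<close> below\<close>
  define T where "T = max 1 (- p 0 / k)"
  define m where "m = b\<^sup>2 / e"
  define K where "K = 2 * e / m\<^sup>2 + b\<^sup>2"
  have K: "K > 0"
    using b_sq_pos e_pos b by (simp add: K_def m_def add_nonneg_pos)
  have "sqrt e - a' t \<le> (K * C / sqrt e) / t\<^sup>2" if "t \<ge> T" for t
  proof -
    have t: "t > 0" "p 0 + k * t \<ge> 0"
      using that k(1) by (auto simp: T_def field_simps)
    then have "p t \<ge> 0"
      using k(2)[of 0 t] by simp
    then have a'_nonneg: "a' t \<ge> 0"
      using a_pos[of t] by (simp add: p_def zero_le_mult_iff)
    have a4: "m\<^sup>2 \<le> a t ^ 4"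
      using power_mono[OF a_sq_ge, of 2 t] b_sq_pos by (simp add: m_def flip: power_mult)
    have "2 * (a' t)\<^sup>2 / a t ^ 4 \<le> 2 * e / m\<^sup>2"
      using speed_sq_le a4 b_sq_pos e_pos by (intro frac_le) (auto simp: m_def)
    then have "(2 * (a' t)\<^sup>2 / a t ^ 4 + b\<^sup>2) * (1 / (a t)\<^sup>2) \<le> K * (C / t\<^sup>2)"
      using C(2)[OF t(1)] K a_pos[of t] by (intro mult_mono) (auto simp: K_def)
    moreover have "e - (a' t)\<^sup>2 = (2 * (a' t)\<^sup>2 / a t ^ 4 + b\<^sup>2) * (1 / (a t)\<^sup>2)"
      unfolding energy[of t, symmetric] by (simp add: field_simps eval_nat_numeral)
    moreover have "(sqrt e - a' t) * sqrt e \<le> (sqrt e - a' t) * (sqrt e + a' t)"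
      using a'_nonneg speed_less[of t] by (intro mult_left_mono) auto
    moreover have "\<dots> = e - (a' t)\<^sup>2"
      using e_pos by (simp add: algebra_simps power2_eq_square)
    ultimately have "(sqrt e - a' t) * sqrt e \<le> K * (C / t\<^sup>2)"
      by linarith
    then have "sqrt e - a' t \<le> K * (C / t\<^sup>2) / sqrt e"
      using e_pos by (subst pos_le_divide_eq) auto
    then show ?thesis
      by (simp add: mult.commute)
  qed
  moreover have "K * C / sqrt e > 0" "T > 0"
    using K C(1) e_pos by (auto simp: T_def)
  ultimately show ?thesis by blast
qed

section \<open>Limits of radius and angle\<close>

definition abar :: "real \<Rightarrow> real" where
  "abar t = sqrt e * t + 1 - integral {0..} (\<lambda>s. sqrt e - a' s)"

definition \<beta>lim :: real where
  "\<beta>lim = b * integral {0..} (\<lambda>s. 1 / (a s)\<^sup>2)"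

text \<open>
  The difference \<open>a - abar\<close> is the integral of the speed deficit over \<open>{t..}\<close>.
\<close>

lemma radius_asymptotics:
  shows speed_deficit_integrable: "(\<lambda>s. sqrt e - a' s) integrable_on {0..}"
    and abar_less: "abar t < a t"
    and abar_tendsto: "((\<lambda>t. a t - abar t) \<longlongrightarrow> 0) at_top"
    and abar_decay: "\<exists>C>0. \<exists>T>0. \<forall>t\<ge>T. a t - abar t \<le> C / t"
proof -
  obtain C T where CT: "C > 0" "T > 0" "\<And>t. t \<ge> T \<Longrightarrow> sqrt e - a' t \<le> C / t\<^sup>2"
    using speed_deficit_decay by blast
  define F where "F t = sqrt e * t + 1 - a t" for t
  have F: "(F has_real_derivative sqrt e - a' t) (at t)" for t
    unfolding F_def by (auto intro!: derivative_eq_intros deriv_a)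
  have pos: "sqrt e - a' t > 0" for t
    using speed_less[of t] by simp
  obtain L where L: "(F \<longlongrightarrow> L) at_top" "\<And>t. F t < L" "\<And>t. t \<ge> T \<Longrightarrow> L - F t \<le> C / t"
    using convergence_with_quadratic_rate[OF F pos CT(3,2)] by blast
  have I: "((\<lambda>s. sqrt e - a' s) has_integral L) {0..}"
    using has_integral_nonneg_derivative_to_inf[OF F _ L(1), of 0] pos
    by (auto simp: F_def init less_imp_le)
  then show "(\<lambda>s. sqrt e - a' s) integrable_on {0..}" by blast
  have eq: "a t - abar t = L - F t" for t
    using integral_unique[OF I] by (simp add: abar_def F_def)
  show "abar t < a t" for t using L(2)[of t] eq[of t] by simp
  show "((\<lambda>t. a t - abar t) \<longlongrightarrow> 0) at_top"
    unfolding eq using tendsto_diff[OF tendsto_const L(1), of L] by simp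
  show "\<exists>C>0. \<exists>T>0. \<forall>t\<ge>T. a t - abar t \<le> C / t"
    unfolding eq using CT L(3) by blast
qed

definition \<delta> :: "real \<Rightarrow> real" where
  "\<delta> t = \<beta> t - \<beta>lim"

text \<open>
  The remaining angle \<open>\<delta>\<close> is \<open>- b\<close> times the integral of \<open>a\<^sup>-\<^sup>2\<close> over \<open>{t..}\<close>.
\<close>

lemma angle_asymptotics:
  shows inverse_square_integrable: "(\<lambda>s. 1 / (a s)\<^sup>2) integrable_on {0..}"
    and \<delta>_nz: "\<delta> t \<noteq> 0"
    and \<delta>_tendsto: "(\<delta> \<longlongrightarrow> 0) at_top"
    and \<delta>_decay: "\<exists>C>0. \<exists>T>0. \<forall>t\<ge>T. \<bar>\<delta> t\<bar> \<le> C / t"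
proof -
  obtain C where C: "C > 0" "\<And>t. t > 0 \<Longrightarrow> 1 / (a t)\<^sup>2 \<le> C / t\<^sup>2"
    using inverse_square_decay by blast
  define F where "F t = \<beta> t / b" for t
  have F: "(F has_real_derivative 1 / (a t)\<^sup>2) (at t)" for t
    unfolding F_def using b by (auto intro!: derivative_eq_intros deriv_\<beta>)
  have pos: "1 / (a t)\<^sup>2 > 0" for t
    by simp
  obtain L where L: "(F \<longlongrightarrow> L) at_top" "\<And>t. F t < L" "\<And>t. t \<ge> 1 \<Longrightarrow> L - F t \<le> C / t"
    using convergence_with_quadratic_rate[OF F pos, of 1 C] C(2) by auto
  have I: "((\<lambda>s. 1 / (a s)\<^sup>2) has_integral L) {0..}"
    using has_integral_nonneg_derivative_to_inf[OF F _ L(1), of 0] pos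
    by (auto simp: F_def init less_imp_le)
  then show "(\<lambda>s. 1 / (a s)\<^sup>2) integrable_on {0..}" by blast
  have eq: "\<delta> t = b * (F t - L)" for t
    using integral_unique[OF I] b by (simp add: \<delta>_def \<beta>lim_def F_def algebra_simps)
  show "\<delta> t \<noteq> 0" for t using L(2)[of t] b eq[of t] by simp
  show "(\<delta> \<longlongrightarrow> 0) at_top"
    unfolding eq[abs_def] using tendsto_mult_left[OF tendsto_diff[OF L(1) tendsto_const, of L], of b] by simp
  have "\<bar>\<delta> t\<bar> \<le> \<bar>b\<bar> * C / t" if "t \<ge> 1" for t
  proof -
    have "\<bar>\<delta> t\<bar> = \<bar>b\<bar> * (L - F t)"
      unfolding eq abs_mult using L(2)[of t] by simp
    also have "\<dots> \<le> \<bar>b\<bar> * (C / t)"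
      using L(3)[OF that] by (intro mult_left_mono) auto
    finally show ?thesis by simp
  qed
  then show "\<exists>C>0. \<exists>T>0. \<forall>t\<ge>T. \<bar>\<delta> t\<bar> \<le> C / t"
    using C(1) b by (intro exI[of _ "\<bar>b\<bar> * C"] conjI exI[of _ 1]) auto
qed

lemma speed_tendsto: "(a' \<longlongrightarrow> sqrt e) at_top"
proof -
  obtain C T where CT: "C > 0" "T > 0" "\<And>t. t \<ge> T \<Longrightarrow> sqrt e - a' t \<le> C / t\<^sup>2"
    using speed_deficit_decay by blast
  have lim: "((\<lambda>t. C / t\<^sup>2) \<longlongrightarrow> 0) at_top"
    by (intro real_tendsto_divide_at_top[OF tendsto_const] filterlim_pow_at_top filterlim_ident) simp
  have "((\<lambda>t. sqrt e - a' t) \<longlongrightarrow> 0) at_top"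
    by (rule tendsto_sandwich[OF _ _ tendsto_const lim])
      (use speed_less CT in \<open>auto intro!: always_eventually eventually_at_top_linorderI[of T]
        simp: abs_less_iff less_imp_le\<close>)
  from tendsto_diff[OF tendsto_const[of "sqrt e"] this] show ?thesis by simp
qed

lemma radius_le: "t \<ge> 0 \<Longrightarrow> a t \<le> sqrt e * t + 1"
proof -
  assume t: "t \<ge> 0"
  have "a t - sqrt e * t \<le> a 0 - sqrt e * 0"
  proof (rule DERIV_nonpos_imp_nonincreasing[OF t])
    fix x
    show "\<exists>y. ((\<lambda>t. a t - sqrt e * t) has_real_derivative y) (at x) \<and> y \<le> 0"
      using speed_less[of x] by (intro exI[of _ "a' x - sqrt e"]) (auto intro!: derivative_eq_intros deriv_a)
  qed
  then show ?thesis by (simp add: init)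
qed

text \<open>
  Since \<open>a'\<close> is nearly \<open>\<surd>e\<close>, the function \<open>- b / (\<surd>e a)\<close> has nearly the same derivative as \<open>\<delta>\<close> and
  the same limit. Their difference decays so fast that it still vanishes after multiplication by \<open>a\<close>.
\<close>

lemma radius_times_\<delta>: "((\<lambda>t. a t * \<delta> t) \<longlongrightarrow> - (b / sqrt e)) at_top"
proof -
  define \<epsilon> where "\<epsilon> = b / sqrt e"
  obtain C where C: "C > 0" "\<And>t. t > 0 \<Longrightarrow> 1 / (a t)\<^sup>2 \<le> C / t\<^sup>2"
    using inverse_square_decay by blast
  obtain D T where DT: "D > 0" "T > 0" "\<And>t. t \<ge> T \<Longrightarrow> sqrt e - a' t \<le> D / t\<^sup>2"
    using speed_deficit_decay by blast
  \<comment> \<open>\<open>u' = \<epsilon> (\<surd>e - a') / a\<^sup>2\<close>: the leading parts of the two derivatives cancel\<close>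
  define u where "u t = \<delta> t + \<epsilon> / a t" for t
  define K where "K = \<bar>\<epsilon>\<bar> * (D * C)"
  define S where "S = max 1 T"
  have u_le: "\<bar>u t\<bar> \<le> (K / 2) / t\<^sup>2" if "t \<ge> S" for t
  proof (rule abs_le_of_derivative_decay[OF _ _ _ _ _ that])
    fix t assume t: "t \<ge> S"
    then have t1: "t \<ge> 1" "t \<ge> T" by (auto simp: S_def)
    show "(u has_real_derivative \<epsilon> * ((sqrt e - a' t) * (1 / (a t)\<^sup>2))) (at t)"
      unfolding u_def \<delta>_def \<epsilon>_def using e_pos
      by (auto intro!: derivative_eq_intros deriv_a deriv_\<beta> simp: field_simps power2_eq_square)
    show "((\<lambda>t. (K / 2) / t\<^sup>2) has_real_derivative - (K / t ^ 3)) (at t)"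
      using t1 by (auto intro!: derivative_eq_intros simp: field_simps eval_nat_numeral)
    have "(sqrt e - a' t) * (1 / (a t)\<^sup>2) \<le> (D / t\<^sup>2) * (C / t\<^sup>2)"
      using DT(1) DT(3)[OF t1(2)] C(2)[of t] t1 by (intro mult_mono) auto
    also have "\<dots> = D * C / t ^ 4"
      by (simp flip: power_add)
    also have "\<dots> \<le> D * C / t ^ 3"
      using t1 C DT by (intro divide_left_mono power_increasing) auto
    finally have "\<bar>\<epsilon>\<bar> * ((sqrt e - a' t) * (1 / (a t)\<^sup>2)) \<le> \<bar>\<epsilon>\<bar> * (D * C / t ^ 3)"
      by (rule mult_left_mono) simp
    moreover have "sqrt e - a' t > 0"
      using speed_less[of t] by simp
    ultimately show "\<bar>\<epsilon> * ((sqrt e - a' t) * (1 / (a t)\<^sup>2))\<bar> \<le> - (- (K / t ^ 3))"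
      by (simp add: K_def abs_mult)
  next
    show "(u \<longlongrightarrow> 0) at_top"
      unfolding u_def[abs_def]
      using tendsto_add[OF \<delta>_tendsto real_tendsto_divide_at_top[OF tendsto_const tends_to_infinity]]
      by simp
    show "((\<lambda>t. (K / 2) / t\<^sup>2) \<longlongrightarrow> 0) at_top"
      by (intro real_tendsto_divide_at_top[OF tendsto_const] filterlim_pow_at_top filterlim_ident) simp
  qed
  have "((\<lambda>t. a t * u t) \<longlongrightarrow> 0) at_top"
  proof (rule Lim_null_comparison)
    show "\<forall>\<^sub>F t in at_top. norm (a t * u t) \<le> (sqrt e + 1) * (K / 2) / t"
    proof (rule eventually_at_top_linorderI[of S])
      fix t assume t: "t \<ge> S"
      then have t1: "t \<ge> 1" by (simp add: S_def)
      have "a t \<le> (sqrt e + 1) * t"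
        using radius_le[of t] t1 by (simp add: algebra_simps)
      then have "a t * \<bar>u t\<bar> \<le> ((sqrt e + 1) * t) * ((K / 2) / t\<^sup>2)"
        using u_le[OF t] e_pos t1 by (intro mult_mono) auto
      also have "\<dots> = (sqrt e + 1) * (K / 2) / t"
        using t1 by (simp add: power2_eq_square)
      finally show "norm (a t * u t) \<le> (sqrt e + 1) * (K / 2) / t"
        using a_pos[of t] by (simp add: abs_mult)
    qed
    show "((\<lambda>t. (sqrt e + 1) * (K / 2) / t) \<longlongrightarrow> 0) at_top"
      by (intro real_tendsto_divide_at_top[OF tendsto_const] filterlim_ident)
  qed
  from tendsto_diff[OF this tendsto_const[of \<epsilon>]] show ?thesis
    by (simp add: u_def \<epsilon>_def distrib_left)
qed

lemma radius_sin_\<delta>: "((\<lambda>t. a t * sin (\<delta> t)) \<longlongrightarrow> - (b / sqrt e)) at_top"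
proof -
  have "((\<lambda>h::real. sin h / h) \<longlongrightarrow> 1) (at 0)"
    using DERIV_sin[of "0::real"] by (simp add: DERIV_def)
  moreover have "filterlim \<delta> (at 0) at_top"
    using \<delta>_tendsto \<delta>_nz by (simp add: filterlim_at)
  ultimately have "((\<lambda>t. sin (\<delta> t) / \<delta> t) \<longlongrightarrow> 1) at_top"
    by (rule filterlim_compose)
  from tendsto_mult[OF radius_times_\<delta> this] show ?thesis
    using \<delta>_nz by simp
qed

text \<open>
  Here \<open>1 - cos \<delta> \<le> \<delta>\<^sup>2\<close>, and one factor \<open>\<delta>\<close> is absorbed by \<open>a\<close>.
\<close>

lemma radius_versine_\<delta>: "((\<lambda>t. a t * (1 - cos (\<delta> t))) \<longlongrightarrow> 0) at_top"
proof (rule Lim_null_comparison)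
  show "((\<lambda>t. \<bar>a t * \<delta> t * \<delta> t\<bar>) \<longlongrightarrow> 0) at_top"
    using tendsto_rabs[OF tendsto_mult[OF radius_times_\<delta> \<delta>_tendsto]] by simp
  have "norm (a t * (1 - cos (\<delta> t))) \<le> \<bar>a t * \<delta> t * \<delta> t\<bar>" for t
  proof -
    have "1 - cos (\<delta> t) = 2 * (sin (\<delta> t / 2))\<^sup>2"
      using cos_double_sin[of "\<delta> t / 2"] by simp
    also have "\<dots> \<le> 2 * (\<delta> t / 2)\<^sup>2"
      using abs_sin_x_le_abs_x[of "\<delta> t / 2"] abs_le_square_iff by (intro mult_left_mono) (blast, simp)
    also have "\<dots> \<le> \<delta> t * \<delta> t"
      by (simp add: power2_eq_square)
    finally have "a t * (1 - cos (\<delta> t)) \<le> a t * (\<delta> t * \<delta> t)"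
      using a_pos[of t] by (intro mult_left_mono) auto
    then show ?thesis
      using a_pos[of t] by (simp add: abs_mult mult.assoc)
  qed
  then show "\<forall>\<^sub>F t in at_top. norm (a t * (1 - cos (\<delta> t))) \<le> \<bar>a t * \<delta> t * \<delta> t\<bar>"
    by simp
qed

section \<open>The deviation from a straight line\<close>

text \<open>
  As \<open>b\<^sup>2 / a\<^sup>3 = a \<beta>'\<^sup>2\<close>, the left-hand side is the radial acceleration of the plane curve
  \<open>a e\<^sup>i\<^sup>\<beta>\<close>, while its angular acceleration vanishes.
\<close>

lemma normal_acceleration:
  "a'' t - b\<^sup>2 / a t ^ 3 = (6 * (a' t)\<^sup>2 - 2 * b\<^sup>2 / (a t)\<^sup>2) / (a t * (a t ^ 6 + 2))"
proof -
  have "(a'' t - b\<^sup>2 / a t ^ 3) * (a t * (a t ^ 6 + 2))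
      = (a t ^ 6 + 2) * (a t * a'' t) - b\<^sup>2 * a t ^ 4 - 2 * b\<^sup>2 / (a t)\<^sup>2"
    by (simp add: field_simps eval_nat_numeral)
  then show ?thesis
    unfolding accel by (simp add: eq_divide_eq)
qed

text \<open>
  The true order is \<open>a\<^sup>-\<^sup>7\<close>. The weaker \<open>t\<^sup>-\<^sup>4\<close> suffices, because the last diagonal entry \<open>a\<^sup>-\<^sup>2\<close> of the
  motion limits the final expansion to \<open>t\<^sup>-\<^sup>2\<close> anyway.
\<close>

lemma normal_acceleration_decay: "\<exists>C>0. \<forall>t\<ge>1. \<bar>a'' t - b\<^sup>2 / a t ^ 3\<bar> \<le> C / t ^ 4"
proof -
  obtain c where c: "c > 0" "\<And>t. c * (1 + \<bar>t\<bar>) \<le> a t"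
    using linear_growth by blast
  have "\<bar>a'' t - b\<^sup>2 / a t ^ 3\<bar> \<le> (8 * e / c ^ 7) / t ^ 4" if t: "t \<ge> 1" for t
  proof -
    have pos: "a t * (a t ^ 6 + 2) > 0"
      using a_pos[of t] by (simp add: add_pos_pos)
    have "(a' t)\<^sup>2 \<le> e"
      by (rule speed_sq_le)
    moreover have "0 \<le> b\<^sup>2 / (a t)\<^sup>2"
      by simp
    moreover have "b\<^sup>2 / (a t)\<^sup>2 \<le> e"
      using a_sq_ge[of t] e_pos a_pos[of t] by (simp add: field_simps)
    moreover have "2 * b\<^sup>2 / (a t)\<^sup>2 = 2 * (b\<^sup>2 / (a t)\<^sup>2)"
      by simp
    ultimately have "\<bar>6 * (a' t)\<^sup>2 - 2 * b\<^sup>2 / (a t)\<^sup>2\<bar> \<le> 8 * e"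
      using zero_le_power2[of "a' t"] e_pos by linarith
    moreover have "c ^ 7 * t ^ 4 \<le> a t * (a t ^ 6 + 2)"
    proof -
      have "c ^ 7 * t ^ 4 \<le> c ^ 7 * t ^ 7"
        using c t by (intro mult_left_mono power_increasing) auto
      also have "\<dots> \<le> a t ^ 7"
        using c(1) c(2)[of t] t by (auto intro!: power_mono simp: algebra_simps simp flip: power_mult_distrib)
      also have "\<dots> \<le> a t * (a t ^ 6 + 2)"
        using a_pos[of t] by (simp add: algebra_simps eval_nat_numeral)
      finally show ?thesis .
    qed
    ultimately have "\<bar>6 * (a' t)\<^sup>2 - 2 * b\<^sup>2 / (a t)\<^sup>2\<bar> / (a t * (a t ^ 6 + 2)) \<le> 8 * e / (c ^ 7 * t ^ 4)"
      using c(1) t e_pos by (intro frac_le) auto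
    then show ?thesis
      using pos unfolding normal_acceleration abs_divide by simp
  qed
  then show ?thesis
    using c(1) e_pos by (intro exI[of _ "8 * e / c ^ 7"]) auto
qed

text \<open>
  Multiplying \<open>a e\<^sup>i\<^sup>\<beta>\<close> by the constant \<open>cis (- \<beta>lim)\<close> turns it into \<open>a e\<^sup>i\<^sup>\<delta>\<close>, whose acceleration is
  \<open>(a'' - a \<beta>'\<^sup>2) e\<^sup>i\<^sup>\<delta>\<close>. Its real and imaginary parts approach the line \<open>abar - i b / \<surd>e\<close> together with
  their derivatives, so the decay of the acceleration can be integrated twice.
\<close>

lemma rotated_asymptotics:
  "\<exists>C>0. \<forall>t\<ge>1. \<bar>a t * cos (\<delta> t) - abar t\<bar> \<le> C / t\<^sup>2 \<and> \<bar>a t * sin (\<delta> t) + b / sqrt e\<bar> \<le> C / t\<^sup>2"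
proof -
  obtain C where C: "C > 0" "\<And>t. t \<ge> 1 \<Longrightarrow> \<bar>a'' t - b\<^sup>2 / a t ^ 3\<bar> \<le> C / t ^ 4"
    using normal_acceleration_decay by blast
  have \<delta>: "(\<delta> has_real_derivative b / (a t)\<^sup>2) (at t)" for t
    unfolding \<delta>_def[abs_def] by (auto intro!: derivative_eq_intros deriv_\<beta>)
  note derivs = derivative_eq_intros deriv_a deriv_a' \<delta>
  have b_over_a: "((\<lambda>t. b / a t) \<longlongrightarrow> 0) at_top"
    by (rule real_tendsto_divide_at_top[OF tendsto_const tends_to_infinity])
  have cos_lim: "((\<lambda>t. cos (\<delta> t)) \<longlongrightarrow> 1) at_top" and sin_lim: "((\<lambda>t. sin (\<delta> t)) \<longlongrightarrow> 0) at_top"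
    using tendsto_cos[OF \<delta>_tendsto] tendsto_sin[OF \<delta>_tendsto] by simp_all
  have le: "\<bar>(a'' t - b\<^sup>2 / a t ^ 3) * r\<bar> \<le> C / t ^ 4" if "\<bar>r\<bar> \<le> 1" "t \<ge> 1" for r t
    using mult_mono[OF C(2)[OF that(2)] that(1)] C(1) that(2) by (simp add: abs_mult)
  have "\<bar>a t * cos (\<delta> t) - abar t\<bar> \<le> (C / 6) / t\<^sup>2" if "t \<ge> 1" for t
  proof (rule abs_le_of_second_derivative_decay[where T = 1, OF _ _ _ _ _ _ that])
    show "((\<lambda>t. a t * cos (\<delta> t) - abar t) has_real_derivative
        a' t * cos (\<delta> t) - b / a t * sin (\<delta> t) - sqrt e) (at t)" for t
      unfolding abar_def by (auto intro!: derivs simp: field_simps power2_eq_square)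
    show "((\<lambda>t. a' t * cos (\<delta> t) - b / a t * sin (\<delta> t) - sqrt e) has_real_derivative
        (a'' t - b\<^sup>2 / a t ^ 3) * cos (\<delta> t)) (at t)" for t
      by (auto intro!: derivs simp: field_simps eval_nat_numeral)
    show "((\<lambda>t. a t * cos (\<delta> t) - abar t) \<longlongrightarrow> 0) at_top"
      using tendsto_diff[OF abar_tendsto radius_versine_\<delta>] by (simp add: algebra_simps)
    show "((\<lambda>t. a' t * cos (\<delta> t) - b / a t * sin (\<delta> t) - sqrt e) \<longlongrightarrow> 0) at_top"
      using tendsto_diff[OF tendsto_diff[OF tendsto_mult[OF speed_tendsto cos_lim]
          tendsto_mult[OF b_over_a sin_lim]] tendsto_const[of "sqrt e"]] by simp
  qed (use le in auto)
  moreover have "\<bar>a t * sin (\<delta> t) + b / sqrt e\<bar> \<le> (C / 6) / t\<^sup>2" if "t \<ge> 1" for t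
  proof (rule abs_le_of_second_derivative_decay[where T = 1, OF _ _ _ _ _ _ that])
    show "((\<lambda>t. a t * sin (\<delta> t) + b / sqrt e) has_real_derivative
        a' t * sin (\<delta> t) + b / a t * cos (\<delta> t)) (at t)" for t
      by (auto intro!: derivs simp: field_simps power2_eq_square)
    show "((\<lambda>t. a' t * sin (\<delta> t) + b / a t * cos (\<delta> t)) has_real_derivative
        (a'' t - b\<^sup>2 / a t ^ 3) * sin (\<delta> t)) (at t)" for t
      by (auto intro!: derivs simp: field_simps eval_nat_numeral)
    show "((\<lambda>t. a t * sin (\<delta> t) + b / sqrt e) \<longlongrightarrow> 0) at_top"
      using tendsto_add[OF radius_sin_\<delta> tendsto_const[of "b / sqrt e"]] by simp
    show "((\<lambda>t. a' t * sin (\<delta> t) + b / a t * cos (\<delta> t)) \<longlongrightarrow> 0) at_top"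
      using tendsto_add[OF tendsto_mult[OF speed_tendsto sin_lim] tendsto_mult[OF b_over_a cos_lim]] by simp
  qed (use le in auto)
  ultimately show ?thesis
    using C(1) by (intro exI[of _ "C / 6"]) auto
qed

section \<open>Sign and decay of the curvature\<close>

definition curvature :: "real \<Rightarrow> real" where
  "curvature t = (3 * (a' t / a t)\<^sup>2 - (b / (a t)\<^sup>2)\<^sup>2) / (e * sqrt (2 / (a t)\<^sup>2 + a t ^ 4))"

lemma normal_length_pos: "2 / (a t)\<^sup>2 + a t ^ 4 > 0"
  using a_pos[of t] by (intro add_pos_pos) auto

lemma curvature_via_p: "curvature t = (3 * (p t)\<^sup>2 - b\<^sup>2) / (a t ^ 4 * (e * sqrt (2 / (a t)\<^sup>2 + a t ^ 4)))"
proof -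
  have "3 * (a' t / a t)\<^sup>2 - (b / (a t)\<^sup>2)\<^sup>2 = (3 * (p t)\<^sup>2 - b\<^sup>2) / a t ^ 4"
    by (simp add: p_def field_simps eval_nat_numeral)
  then show ?thesis by (simp add: curvature_def)
qed

text \<open>
  The positive minimal rate of increase of \<open>p\<close> carries it past every value within a bounded time.
\<close>

lemma p_surj: "\<exists>t. p t = y"
proof -
  obtain k where k: "k > 0" "\<And>s t. s \<le> t \<Longrightarrow> p s + k * (t - s) \<le> p t"
    using p_increment by blast
  \<comment> \<open>a time by which \<open>p\<close>, moving at rate at least \<open>k\<close>, has covered the distance from \<open>p 0\<close> to \<open>y\<close>\<close>
  define M where "M = \<bar>y - p 0\<bar> / k"
  have "p (- M) \<le> y" "y \<le> p M" "- M \<le> M"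
    using k(1) k(2)[of "- M" 0] k(2)[of 0 M] by (auto simp: M_def)
  then have "\<exists>t. - M \<le> t \<and> t \<le> M \<and> p t = y"
    by (intro IVT') (auto intro!: continuous_at_imp_continuous_on DERIV_isCont[OF deriv_p])
  then show ?thesis by blast
qed

lemma p_less_iff: "p s < p t \<longleftrightarrow> s < t"
proof -
  obtain k where k: "k > 0" "\<And>s t. s \<le> t \<Longrightarrow> p s + k * (t - s) \<le> p t"
    using p_increment by blast
  have "p s < p t" if "s < t" for s t
    using k(1) k(2)[of s t] that by (smt (verit) mult_pos_pos)
  then show ?thesis
    by (metis linorder_neqE_linordered_idom order_less_asym)
qed

text \<open>
  The zeros of the curvature are the times at which \<open>p = \<plusminus> \<bar>b\<bar> / \<surd>3\<close>.
\<close>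

lemma curvature_sign:
  "\<exists>t1 t2. t1 < t2 \<and> (\<forall>t\<in>{t1<..<t2}. curvature t < 0) \<and> (\<forall>t\<in>UNIV - {t1..t2}. 0 < curvature t)"
proof -
  define r where "r = \<bar>b\<bar> / sqrt 3"
  have r: "r > 0" "3 * r\<^sup>2 = b\<^sup>2"
    using b by (auto simp: r_def power_divide)
  obtain t1 t2 where t12: "p t1 = - r" "p t2 = r"
    using p_surj by metis
  have den: "a t ^ 4 * (e * sqrt (2 / (a t)\<^sup>2 + a t ^ 4)) > 0" for t
    using a_pos[of t] e_pos normal_length_pos[of t] by simp
  have neg: "curvature t < 0 \<longleftrightarrow> \<bar>p t\<bar> < r" and pos: "curvature t > 0 \<longleftrightarrow> r < \<bar>p t\<bar>" for t
  proof -
    have "curvature t < 0 \<longleftrightarrow> (p t)\<^sup>2 < r\<^sup>2" "curvature t > 0 \<longleftrightarrow> r\<^sup>2 < (p t)\<^sup>2"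
      unfolding curvature_via_p r(2)[symmetric] pos_divide_less_eq[OF den] pos_less_divide_eq[OF den] by auto
    then show "curvature t < 0 \<longleftrightarrow> \<bar>p t\<bar> < r" "curvature t > 0 \<longleftrightarrow> r < \<bar>p t\<bar>"
      using abs_le_square_iff[of r "p t"] abs_le_square_iff[of "p t" r] r(1) by auto
  qed
  have "t1 < t2"
    using r(1) t12 p_less_iff[of t1 t2] by simp
  moreover have "curvature t < 0" if "t \<in> {t1<..<t2}" for t
    using that t12 p_less_iff[of t1 t] p_less_iff[of t t2] unfolding neg by auto
  moreover have "0 < curvature t" if "t \<in> UNIV - {t1..t2}" for t
    using that t12 p_less_iff[of t t1] p_less_iff[of t2 t] unfolding pos by auto
  ultimately show ?thesis by blast
qed

text \<open>
  The numerator is at most \<open>3 e / a\<^sup>2\<close> and the denominator at least \<open>e a\<^sup>2\<close>.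
\<close>

lemma curvature_decay: "\<exists>C>0. \<forall>t. curvature t \<le> C / (1 + \<bar>t\<bar>) ^ 4"
proof -
  obtain c where c: "c > 0" "\<And>t. c * (1 + \<bar>t\<bar>) \<le> a t"
    using linear_growth by blast
  have "curvature t \<le> (3 / c ^ 4) / (1 + \<bar>t\<bar>) ^ 4" for t
  proof -
    have "(a t)\<^sup>2 = sqrt (a t ^ 4)"
      by (rule real_sqrt_unique[symmetric]) (auto simp flip: power_mult)
    also have "\<dots> \<le> sqrt (2 / (a t)\<^sup>2 + a t ^ 4)"
      by simp
    finally have "e * (a t)\<^sup>2 \<le> e * sqrt (2 / (a t)\<^sup>2 + a t ^ 4)"
      using e_pos by simp
    moreover have "3 * (a' t / a t)\<^sup>2 - (b / (a t)\<^sup>2)\<^sup>2 \<le> 3 * e / (a t)\<^sup>2"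
    proof -
      have "(a' t / a t)\<^sup>2 \<le> e / (a t)\<^sup>2"
        unfolding power_divide using speed_sq_le by (intro divide_right_mono) auto
      then show ?thesis
        using zero_le_power2[of "b / (a t)\<^sup>2"] unfolding times_divide_eq_right[symmetric] by linarith
    qed
    ultimately have "curvature t \<le> (3 * e / (a t)\<^sup>2) / (e * (a t)\<^sup>2)"
      unfolding curvature_def using e_pos by (intro frac_le) auto
    also have "\<dots> = 3 / a t ^ 4"
      using e_pos by (simp add: field_simps eval_nat_numeral)
    also have "\<dots> \<le> 3 / (c * (1 + \<bar>t\<bar>)) ^ 4"
      using c by (intro divide_left_mono power_mono) auto
    finally show ?thesis
      by (simp add: power_mult_distrib)
  qed
  then show ?thesis
    using c(1) by (intro exI[of _ "3 / c ^ 4"]) auto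
qed

section \<open>The motion of matrices\<close>

definition motion :: "real \<Rightarrow> real^3^3" where
  "motion t = block_embed (Complex (a t) 0 * cis (\<beta> t)) (1 / (a t)\<^sup>2)"

definition velocity :: "real \<Rightarrow> real^3^3" where
  "velocity t = block_embed (Complex (a' t) (b / a t) * cis (\<beta> t)) (- 2 * a' t / a t ^ 3)"

text \<open>
  The Lagrange multiplier \<open>\<Lambda>\<close> along the motion, computed from \<open>A' A\<^sup>-\<^sup>1 = (a'/a + i \<beta>', - 2 a'/a)\<close>.
\<close>

definition multiplier :: "real \<Rightarrow> real" where
  "multiplier t = (6 * (a' t / a t)\<^sup>2 - 2 * (b / (a t)\<^sup>2)\<^sup>2) / (2 / (a t)\<^sup>2 + a t ^ 4)"

lemma inv_transpose_motion: "inv_transpose (motion t) = block_embed (Complex (1 / a t) 0 * cis (\<beta> t)) ((a t)\<^sup>2)"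
  unfolding motion_def by (subst inv_transpose_block_embed) (auto simp: cis_cnj Complex_eq inverse_eq_divide[symmetric])

lemma det_motion: "det (motion t) = 1"
  by (simp add: motion_def det_block_embed norm_mult cmod_power2)

lemma deriv_motion: "(motion has_vector_derivative velocity t) (at t)"
  unfolding motion_def[abs_def] velocity_def
proof (rule has_vector_derivative_block_embed)
  show "((\<lambda>t. Complex (a t) 0 * cis (\<beta> t)) has_vector_derivative
      Complex (a' t) (b / a t) * cis (\<beta> t)) (at t)"
    using has_vector_derivative_rotating_frame[OF deriv_a DERIV_const[of 0] deriv_\<beta>]
    by (simp add: power2_eq_square)
  show "((\<lambda>t. 1 / (a t)\<^sup>2) has_real_derivative - 2 * a' t / a t ^ 3) (at t)"
    by (auto intro!: derivative_eq_intros deriv_a simp: field_simps eval_nat_numeral)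
qed

lemma multiplier_eq: "multiplier t = (6 * (a' t)\<^sup>2 - 2 * b\<^sup>2 / (a t)\<^sup>2) / (a t ^ 6 + 2)"
proof -
  have "2 / (a t)\<^sup>2 + a t ^ 4 = (a t ^ 6 + 2) / (a t)\<^sup>2"
    by (simp add: field_simps flip: power_add)
  moreover have "6 * (a' t / a t)\<^sup>2 - 2 * (b / (a t)\<^sup>2)\<^sup>2 = (6 * (a' t)\<^sup>2 - 2 * b\<^sup>2 / (a t)\<^sup>2) / (a t)\<^sup>2"
    by (simp add: power_divide diff_divide_distrib power2_eq_square)
  ultimately show ?thesis by (simp add: multiplier_def)
qed

text \<open>
  The last diagonal entry of \<open>A'' = \<Lambda> A\<^sup>-\<^sup>T\<close>. The block and this entry each express the same scalar
  equation of motion, which is what makes the ansatz consistent.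
\<close>

lemma axial_acceleration: "6 * (a' t)\<^sup>2 / a t ^ 4 - 2 * a'' t / a t ^ 3 = multiplier t * (a t)\<^sup>2"
proof -
  have "(6 * (a' t)\<^sup>2 / a t ^ 4 - 2 * a'' t / a t ^ 3) * (a t ^ 6 + 2)
      = (a t ^ 6 + 2) * 6 * (a' t)\<^sup>2 / a t ^ 4 - 2 * ((a t ^ 6 + 2) * (a t * a'' t)) / a t ^ 4"
    by (simp add: field_simps eval_nat_numeral)
  also have "\<dots> = (6 * (a' t)\<^sup>2 - 2 * b\<^sup>2 / (a t)\<^sup>2) * (a t)\<^sup>2"
    unfolding accel by (simp add: field_simps eval_nat_numeral)
  finally show ?thesis
    by (simp add: multiplier_eq eq_divide_eq)
qed

lemma deriv_velocity: "(velocity has_vector_derivative multiplier t *\<^sub>R inv_transpose (motion t)) (at t)"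
proof -
  have "((\<lambda>t. b / a t) has_real_derivative - (b * a' t / (a t)\<^sup>2)) (at t)"
    by (auto intro!: derivative_eq_intros deriv_a simp: power2_eq_square)
  from has_vector_derivative_rotating_frame[OF deriv_a' this deriv_\<beta>]
  have "((\<lambda>t. Complex (a' t) (b / a t) * cis (\<beta> t)) has_vector_derivative
      Complex (a'' t - b\<^sup>2 / a t ^ 3) 0 * cis (\<beta> t)) (at t)"
    by (simp add: eval_nat_numeral)
  moreover have "((\<lambda>t. - 2 * a' t / a t ^ 3) has_real_derivative
      6 * (a' t)\<^sup>2 / a t ^ 4 - 2 * a'' t / a t ^ 3) (at t)"
    by (auto intro!: derivative_eq_intros deriv_a deriv_a' simp: field_simps eval_nat_numeral)
  ultimately have "(velocity has_vector_derivative block_embed (Complex (a'' t - b\<^sup>2 / a t ^ 3) 0 * cis (\<beta> t))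
      (6 * (a' t)\<^sup>2 / a t ^ 4 - 2 * a'' t / a t ^ 3)) (at t)"
    unfolding velocity_def[abs_def] by (rule has_vector_derivative_block_embed)
  moreover have "a'' t - b\<^sup>2 / a t ^ 3 = multiplier t * (1 / a t)"
    by (simp add: normal_acceleration multiplier_eq)
  ultimately show ?thesis
    by (simp add: axial_acceleration inv_transpose_motion block_embed_linear scaleR_conv_of_real[where 'a = complex]
        complex_of_real_def[symmetric] mult.assoc)
qed

lemma affine_multiplier_motion: "affine_multiplier (motion t) (velocity t) = multiplier t"
proof -
  have inv: "matrix_inv (motion t) = block_embed (Complex (1 / a t) 0 * cis (- \<beta> t)) ((a t)\<^sup>2)"
    unfolding motion_def by (subst matrix_inv_block_embed) (auto simp: Complex_eq inverse_eq_divide[symmetric])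
  have "velocity t ** matrix_inv (motion t)
      = block_embed (Complex (a' t / a t) (b / (a t)\<^sup>2)) (- 2 * (a' t / a t))"
    unfolding inv velocity_def block_embed_mult
    by (intro arg_cong2[of _ _ _ _ block_embed])
      (simp_all add: Complex_eq field_simps eval_nat_numeral cis_mult)
  then show ?thesis
    unfolding affine_multiplier_def inv inv_transpose_motion multiplier_def
    by (simp add: block_embed_mult trace_block_embed cis_mult field_simps eval_nat_numeral)
qed

text \<open>
  The Frobenius norm of the velocity is constant by conservation of energy.
\<close>

lemma norm_velocity: "norm (velocity t) = sqrt (2 * e)"
proof -
  have "(cmod (Complex (a' t) (b / a t)))\<^sup>2 = (a' t)\<^sup>2 + (b / a t)\<^sup>2"
    by (simp add: cmod_power2)
  then show ?thesis
    unfolding velocity_def norm_block_embed energy[of t, symmetric]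
    by (simp add: norm_mult power_mult_distrib power_divide) (simp add: field_simps eval_nat_numeral)
qed

lemma motion_incompressible: "incompressible_affine_motion motion"
  unfolding incompressible_affine_motion_def
  using det_motion deriv_motion deriv_velocity affine_multiplier_motion by metis

text \<open>
  At constant speed the curvature vector is the acceleration divided by the squared speed \<open>2 e\<close>, and the
  acceleration is a multiple of the normal.
\<close>

lemma motion_curvature: "has_signed_curvature motion (curvature t) t"
proof -
  have vd: "vector_derivative motion (at t) = velocity t" for t
    by (rule vector_derivative_at[OF deriv_motion])
  have "(unit_tangent motion has_vector_derivative
      (1 / sqrt (2 * e)) *\<^sub>R (multiplier t *\<^sub>R inv_transpose (motion t))) (at t)"
    unfolding unit_tangent_def[abs_def] vd sgn_div_norm norm_velocity inverse_eq_divide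
    by (intro bounded_linear.has_vector_derivative[OF bounded_linear_scaleR_right] deriv_velocity)
  then have cv: "curvature_vector motion t = (multiplier t / (2 * e)) *\<^sub>R inv_transpose (motion t)"
    using e_pos by (simp add: curvature_vector_def vector_derivative_at vd norm_velocity inverse_eq_divide)
  have norm_inv: "norm (inv_transpose (motion t)) = sqrt (2 / (a t)\<^sup>2 + a t ^ 4)"
    unfolding inv_transpose_motion norm_block_embed
    by (simp add: Complex_eq norm_mult norm_divide power_divide flip: power_mult)
  define S where "S = sqrt (2 / (a t)\<^sup>2 + a t ^ 4)"
  define N where "N = 3 * (a' t / a t)\<^sup>2 - (b / (a t)\<^sup>2)\<^sup>2"
  have "2 / (a t)\<^sup>2 + a t ^ 4 = S * S"
    using normal_length_pos[of t] by (simp add: S_def)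
  then have "multiplier t = 2 * N / (S * S)"
    by (simp add: multiplier_def N_def)
  then have "multiplier t / (2 * e) = N / (e * S) * inverse S"
    by (simp only: divide_inverse) simp
  also have "N / (e * S) = curvature t"
    by (simp add: curvature_def N_def S_def)
  finally have coeff: "multiplier t / (2 * e) = curvature t * inverse S" .
  show ?thesis
    unfolding has_signed_curvature_def cv SL_unit_normal_def sgn_div_norm norm_inv S_def[symmetric]
      coeff scaleR_scaleR ..
qed

text \<open>
  The common factor \<open>cis \<beta>lim\<close> is an isometry, so the block differs from its asymptotic line as much as
  in the turned frame; the last diagonal entry tends to 0 like \<open>a\<^sup>-\<^sup>2\<close>.
\<close>

lemma motion_asymptotics:
  "\<exists>C>0. \<forall>t\<ge>1. norm (motion t - block_embed (Complex (abar t) (- (b / sqrt e)) * cis \<beta>lim) 0) \<le> C / t\<^sup>2"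
proof -
  obtain C where C: "C > 0"
    "\<And>t. t \<ge> 1 \<Longrightarrow> \<bar>a t * cos (\<delta> t) - abar t\<bar> \<le> C / t\<^sup>2"
    "\<And>t. t \<ge> 1 \<Longrightarrow> \<bar>a t * sin (\<delta> t) + b / sqrt e\<bar> \<le> C / t\<^sup>2"
    using rotated_asymptotics by blast
  obtain D where D: "D > 0" "\<And>t. t > 0 \<Longrightarrow> 1 / (a t)\<^sup>2 \<le> D / t\<^sup>2"
    using inverse_square_decay by blast
  have "norm (motion t - block_embed (Complex (abar t) (- (b / sqrt e)) * cis \<beta>lim) 0) \<le> (4 * C + D) / t\<^sup>2"
    if t: "t \<ge> 1" for t
  proof -
    define w where "w = Complex (a t * cos (\<delta> t) - abar t) (a t * sin (\<delta> t) + b / sqrt e)"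
    have "of_real (a t) * cis (\<beta> t) - Complex (abar t) (- (b / sqrt e)) * cis \<beta>lim
        = (of_real (a t) * cis (\<delta> t) - Complex (abar t) (- (b / sqrt e))) * cis \<beta>lim"
      by (simp add: left_diff_distrib mult.assoc cis_mult \<delta>_def)
    also have "of_real (a t) * cis (\<delta> t) - Complex (abar t) (- (b / sqrt e)) = w"
      by (simp add: w_def complex_eq_iff)
    finally have "of_real (a t) * cis (\<beta> t) - Complex (abar t) (- (b / sqrt e)) * cis \<beta>lim = w * cis \<beta>lim" .
    then have "norm (motion t - block_embed (Complex (abar t) (- (b / sqrt e)) * cis \<beta>lim) 0)
        = norm (block_embed (w * cis \<beta>lim) (1 / (a t)\<^sup>2))"
      by (simp add: motion_def block_embed_linear Complex_eq)
    also have "\<dots> \<le> 2 * cmod w + 1 / (a t)\<^sup>2"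
      using norm_block_embed_le[of "w * cis \<beta>lim" "1 / (a t)\<^sup>2"] by (simp add: norm_mult)
    also have "\<dots> \<le> 2 * (C / t\<^sup>2 + C / t\<^sup>2) + D / t\<^sup>2"
      using cmod_le[of w] C(2,3)[OF t] D(2)[of t] t by (intro add_mono mult_left_mono) (auto simp: w_def)
    finally show ?thesis
      by (simp add: add_divide_distrib)
  qed
  then show ?thesis
    using C(1) D(1) by (intro exI[of _ "4 * C + D"]) auto
qed

end

section \<open>The initial value problem\<close>

lemma pos_lesssim_largeI:
  assumes "\<And>t. 0 < f t" and "\<exists>C>0. \<exists>T>0. \<forall>t\<ge>T. f t \<le> C * g t"
  shows "pos_lesssim_large f g"
  using assms unfolding pos_lesssim_large_def lesssim_on_def by fastforce

lemma block_diag_as_block_embed: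
  "block_diag (r *\<^sub>R I0) c ** block_diag (matrix_exp (x *\<^sub>R W0)) d = block_embed (Complex r 0 * cis x) (c * d)"
proof -
  have "r *\<^sub>R I0 = complex_matrix (Complex r 0)" "x *\<^sub>R W0 = complex_matrix (\<i> * of_real x)"
    by (simp_all add: complex_matrix_def)
  then show ?thesis
    by (simp add: matrix_exp_complex_matrix block_embed_mult flip: block_embed_def cis_conv_exp)
qed

text \<open>
  The second equation, multiplied by \<open>\<alpha>\<^sup>2\<close>, is the statement that \<open>\<beta>' \<alpha>\<^sup>2\<close> is constant; the first is
  cleared of its denominators.
\<close>

lemma swirling_profileI:
  assumes smooth: "smooth \<alpha>" "smooth \<beta>"
    and pos: "\<And>t. \<alpha> t > 0"
    and ode_\<alpha>: "\<And>t. (1 + 2 * \<alpha> t powi (-6)) * deriv (\<lambda>s. deriv \<alpha> s / \<alpha> s) t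
                   + (1 - 4 * \<alpha> t powi (-6)) * (deriv \<alpha> t / \<alpha> t)\<^sup>2 - (deriv \<beta> t)\<^sup>2 = 0"
    and ode_\<beta>: "\<And>t. deriv (deriv \<beta>) t + 2 * (deriv \<alpha> t / \<alpha> t) * deriv \<beta> t = 0"
    and init: "\<alpha> 0 = 1" "\<beta> 0 = 0" and swirl: "deriv \<beta> 0 \<noteq> 0"
  shows "swirling_profile \<alpha> (deriv \<alpha>) (deriv (deriv \<alpha>)) \<beta> (deriv \<beta> 0) (3 * (deriv \<alpha> 0)\<^sup>2 + (deriv \<beta> 0)\<^sup>2)"
proof
  have nz: "\<alpha> t \<noteq> 0" for t
    using pos[of t] by simp
  have deriv: "(f has_real_derivative deriv f t) (at t)"
    "(deriv f has_real_derivative deriv (deriv f) t) (at t)" if "smooth f" for f t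
    using that[unfolded smooth_def, rule_format, of 0 t] that[unfolded smooth_def, rule_format, of 1 t]
    by (simp_all add: DERIV_deriv_iff_field_differentiable)
  show d\<alpha>: "(\<alpha> has_real_derivative deriv \<alpha> t) (at t)"
    and dd\<alpha>: "(deriv \<alpha> has_real_derivative deriv (deriv \<alpha>) t) (at t)" for t
    by (rule deriv[OF smooth(1)])+
  have deriv_\<beta>: "deriv \<beta> t = deriv \<beta> 0 / (\<alpha> t)\<^sup>2" for t
  proof -
    have "((\<lambda>t. deriv \<beta> t * (\<alpha> t)\<^sup>2) has_real_derivative 0) (at t)" for t
    proof -
      have "((\<lambda>t. deriv \<beta> t * (\<alpha> t)\<^sup>2) has_real_derivative
          (deriv (deriv \<beta>) t + 2 * (deriv \<alpha> t / \<alpha> t) * deriv \<beta> t) * (\<alpha> t)\<^sup>2) (at t)"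
        using nz[of t] by (auto intro!: derivative_eq_intros d\<alpha> deriv[OF smooth(2)]
            simp: field_simps power2_eq_square)
      then show ?thesis unfolding ode_\<beta> by simp
    qed
    then have "deriv \<beta> t * (\<alpha> t)\<^sup>2 = deriv \<beta> 0 * (\<alpha> 0)\<^sup>2"
      by (rule DERIV_isconst_all[rule_format])
    then show ?thesis
      using nz[of t] init by (simp add: field_simps)
  qed
  then show "(\<beta> has_real_derivative deriv \<beta> 0 / (\<alpha> t)\<^sup>2) (at t)" for t
    using deriv(1)[OF smooth(2)] by metis
  show "(\<alpha> t ^ 6 + 2) * (\<alpha> t * deriv (deriv \<alpha>) t) = 6 * (deriv \<alpha> t)\<^sup>2 + (deriv \<beta> 0)\<^sup>2 * \<alpha> t ^ 4" for t
  proof -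
    define h where "h = deriv (deriv \<alpha>) t / \<alpha> t"
    have "((\<lambda>s. deriv \<alpha> s / \<alpha> s) has_real_derivative h - (deriv \<alpha> t / \<alpha> t)\<^sup>2) (at t)"
      using nz[of t] by (auto intro!: derivative_eq_intros d\<alpha> dd\<alpha> simp: h_def field_simps power2_eq_square)
    then have "deriv (\<lambda>s. deriv \<alpha> s / \<alpha> s) t = h - (deriv \<alpha> t / \<alpha> t)\<^sup>2"
      by (rule DERIV_imp_deriv)
    with ode_\<alpha>[of t] have "(1 + 2 / \<alpha> t ^ 6) * (h - (deriv \<alpha> t / \<alpha> t)\<^sup>2)
        + (1 - 4 / \<alpha> t ^ 6) * (deriv \<alpha> t / \<alpha> t)\<^sup>2 - (deriv \<beta> 0 / (\<alpha> t)\<^sup>2)\<^sup>2 = 0"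
      using deriv_\<beta>[of t] by (simp add: power_int_minus divide_inverse)
    then have "(1 + 2 / \<alpha> t ^ 6) * h = 6 / \<alpha> t ^ 6 * (deriv \<alpha> t / \<alpha> t)\<^sup>2 + (deriv \<beta> 0 / (\<alpha> t)\<^sup>2)\<^sup>2"
      by (simp add: algebra_simps)
    moreover have "(1 + 2 / \<alpha> t ^ 6) * h * \<alpha> t ^ 8 = (\<alpha> t ^ 6 + 2) * (\<alpha> t * deriv (deriv \<alpha>) t)"
      using nz[of t] by (simp add: h_def field_simps eval_nat_numeral)
    moreover have "(6 / \<alpha> t ^ 6 * (deriv \<alpha> t / \<alpha> t)\<^sup>2 + (deriv \<beta> 0 / (\<alpha> t)\<^sup>2)\<^sup>2) * \<alpha> t ^ 8
        = 6 * (deriv \<alpha> t)\<^sup>2 + (deriv \<beta> 0)\<^sup>2 * \<alpha> t ^ 4"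
      using nz[of t] by (simp add: field_simps eval_nat_numeral)
    ultimately show ?thesis
      by simp
  qed
qed (use pos init swirl in auto)

theorem theorem8:
  fixes \<alpha>0' \<beta>0' e0 \<beta>bar :: real
    and \<alpha> \<beta> \<alpha>bar \<kappa> :: "real \<Rightarrow> real"
    and A :: "real \<Rightarrow> real^3^3"
  assumes smooth: "smooth \<alpha>" "smooth \<beta>"
    and pos: "\<And>t. \<alpha> t > 0"
    and ode_\<alpha>: "\<And>t. (1 + 2 * \<alpha> t powi (-6)) * deriv (\<lambda>s. deriv \<alpha> s / \<alpha> s) t
                   + (1 - 4 * \<alpha> t powi (-6)) * (deriv \<alpha> t / \<alpha> t)\<^sup>2 - (deriv \<beta> t)\<^sup>2 = 0"
    and ode_\<beta>: "\<And>t. deriv (deriv \<beta>) t + 2 * (deriv \<alpha> t / \<alpha> t) * deriv \<beta> t = 0"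
    and init: "\<alpha> 0 = 1" "deriv \<alpha> 0 = \<alpha>0'" "\<beta> 0 = 0" "deriv \<beta> 0 = \<beta>0'"
    and e0: "e0 = 3 * \<alpha>0'\<^sup>2 + \<beta>0'\<^sup>2" "e0 \<noteq> 0"
    and \<beta>0': "\<beta>0' \<noteq> 0"
    and \<alpha>bar: "\<And>t. \<alpha>bar t = sqrt e0 * t + 1 - integral {0..} (\<lambda>s. sqrt e0 - deriv \<alpha> s)"
    and \<beta>bar: "\<beta>bar = \<beta>0' * integral {0..} (\<lambda>s. \<alpha> s powi (-2))"
    and \<kappa>: "\<And>t. \<kappa> t = (3 * (deriv \<alpha> t / \<alpha> t)\<^sup>2 - (deriv \<beta> t)\<^sup>2)
                       / (e0 * sqrt (2 * \<alpha> t powi (-2) + \<alpha> t ^ 4))"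
    and A: "\<And>t. A t = block_diag (\<alpha> t *\<^sub>R I0) (\<alpha> t powi (-2))
                       ** block_diag (matrix_exp (\<beta> t *\<^sub>R W0)) 1"
  shows "(\<forall>t. deriv \<beta> t = \<beta>0' * \<alpha> t powi (-2) \<and> deriv (deriv \<alpha>) t > 0)
    \<and> pos_lesssim_large (\<lambda>t. sqrt e0 - deriv \<alpha> t) (\<lambda>t. t powi (-2))
    \<and> (\<lambda>s. sqrt e0 - deriv \<alpha> s) integrable_on {0..}
    \<and> pos_lesssim_large (\<lambda>t. \<alpha> t - \<alpha>bar t) (\<lambda>t. t powi (-1))
    \<and> (\<lambda>s. \<alpha> s powi (-2)) integrable_on {0..}
    \<and> pos_lesssim_large (\<lambda>t. \<bar>\<beta> t - \<beta>bar\<bar>) (\<lambda>t. t powi (-1))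
    \<and> incompressible_affine_motion A
    \<and> (\<forall>t. has_signed_curvature A (\<kappa> t) t)
    \<and> (\<exists>t1 t2. t1 < t2
         \<and> (\<forall>t\<in>{t1<..<t2}. \<kappa> t < 0)
         \<and> (\<forall>t\<in>UNIV - {t1..t2}. 0 < \<kappa> t)
         \<and> lesssim_on (UNIV - {t1..t2}) \<kappa> (\<lambda>t. (1 + \<bar>t\<bar>) powi (-4)))
    \<and> bigO_large
         (\<lambda>t. A t - block_diag ((\<alpha>bar t *\<^sub>R I0 - (\<beta>0' / sqrt e0) *\<^sub>R W0)
                                  ** matrix_exp (\<beta>bar *\<^sub>R W0)) 0)
         (\<lambda>t. t powi (-2))"
proof -
  interpret swirling_profile \<alpha> "deriv \<alpha>" "deriv (deriv \<alpha>)" \<beta> \<beta>0' e0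
    using swirling_profileI[OF smooth pos ode_\<alpha> ode_\<beta> init(1,3)] \<beta>0' by (simp add: init e0(1))
  have powi: "x powi (-2) = 1 / x\<^sup>2" "x powi (-4) = 1 / x ^ 4" "x powi (-1) = 1 / x" for x :: real
    by (simp_all add: power_int_minus inverse_eq_divide)
  have \<alpha>bar_eq: "\<alpha>bar = abar"
    by (rule ext) (simp add: \<alpha>bar abar_def)
  have \<beta>bar_eq: "\<beta>bar = \<beta>lim"
    by (simp add: \<beta>bar \<beta>lim_def powi)
  have \<kappa>_eq: "\<kappa> = curvature"
    by (rule ext) (simp add: \<kappa> curvature_def DERIV_imp_deriv[OF deriv_\<beta>] powi)
  have A_eq: "A = motion"
    by (rule ext) (simp add: A motion_def block_diag_as_block_embed powi)
  have line: "block_diag ((\<alpha>bar t *\<^sub>R I0 - (\<beta>0' / sqrt e0) *\<^sub>R W0) ** matrix_exp (\<beta>bar *\<^sub>R W0)) 0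
      = block_embed (Complex (abar t) (- (\<beta>0' / sqrt e0)) * cis \<beta>bar) 0" for t
  proof -
    have "\<alpha>bar t *\<^sub>R I0 - (\<beta>0' / sqrt e0) *\<^sub>R W0 = complex_matrix (Complex (abar t) (- (\<beta>0' / sqrt e0)))"
      "\<beta>bar *\<^sub>R W0 = complex_matrix (\<i> * of_real \<beta>bar)"
      by (simp_all add: complex_matrix_def \<alpha>bar_eq)
    then show ?thesis
      by (simp add: matrix_exp_complex_matrix complex_matrix_mult block_embed_def flip: cis_conv_exp)
  qed
  show ?thesis
  proof (intro conjI allI)
    show "deriv \<beta> t = \<beta>0' * \<alpha> t powi (-2)" "deriv (deriv \<alpha>) t > 0" for t
      using DERIV_imp_deriv[OF deriv_\<beta>] accel_pos by (simp_all add: powi)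
    show "pos_lesssim_large (\<lambda>t. sqrt e0 - deriv \<alpha> t) (\<lambda>t. t powi (-2))"
      using speed_less speed_deficit_decay by (intro pos_lesssim_largeI) (auto simp: powi abs_less_iff)
    show "(\<lambda>s. sqrt e0 - deriv \<alpha> s) integrable_on {0..}"
      by (rule speed_deficit_integrable)
    show "pos_lesssim_large (\<lambda>t. \<alpha> t - \<alpha>bar t) (\<lambda>t. t powi (-1))"
      unfolding \<alpha>bar_eq using abar_less abar_decay by (intro pos_lesssim_largeI) (simp_all add: powi divide_inverse)
    show "(\<lambda>s. \<alpha> s powi (-2)) integrable_on {0..}"
      using inverse_square_integrable by (simp add: powi)
    show "pos_lesssim_large (\<lambda>t. \<bar>\<beta> t - \<beta>bar\<bar>) (\<lambda>t. t powi (-1))"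
      unfolding \<beta>bar_eq using \<delta>_nz \<delta>_decay unfolding \<delta>_def by (intro pos_lesssim_largeI) (simp_all add: powi divide_inverse)
    show "incompressible_affine_motion A" "has_signed_curvature A (\<kappa> t) t" for t
      unfolding A_eq \<kappa>_eq by (rule motion_incompressible motion_curvature)+
    show "\<exists>t1 t2. t1 < t2 \<and> (\<forall>t\<in>{t1<..<t2}. \<kappa> t < 0) \<and> (\<forall>t\<in>UNIV - {t1..t2}. 0 < \<kappa> t)
        \<and> lesssim_on (UNIV - {t1..t2}) \<kappa> (\<lambda>t. (1 + \<bar>t\<bar>) powi (-4))"
      using curvature_sign curvature_decay unfolding \<kappa>_eq lesssim_on_def by (simp add: powi) blast
    show "bigO_large (\<lambda>t. A t - block_diag ((\<alpha>bar t *\<^sub>R I0 - (\<beta>0' / sqrt e0) *\<^sub>R W0)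
        ** matrix_exp (\<beta>bar *\<^sub>R W0)) 0) (\<lambda>t. t powi (-2))"
      using motion_asymptotics unfolding bigO_large_def lesssim_on_def line A_eq unfolding \<beta>bar_eq
      by (intro exI[of _ 1]) (auto simp: powi)
  qed
qed
end
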